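(* Let $z$ and $X=\{x_1,x_2,\ldots\}$ be independent indeterminates. Then the formal power series (in $t$ and $u$) $$F(t,u)=(1+u)^z\prod_{r\ge1}\left(1+\frac{u}{1+u}\,\frac{tx_r}{1-tx_r}\right)$$ admits the following three expansions: $$F(t,u)=\sum_{i,j\ge0}u^it^j\sum_{l(\mu)\le i,\ |\mu|=j}\binom{z-l(\mu)}{i-l(\mu)}m_\mu(X),$$ $$F(t,u)=\sum_{i,j\ge0}u^it^j\sum_{k=0}^{\min(i,j)}\binom{z-j}{i-k}\sum_{\mu\vdash j}\frac{\left\langle{\mu\atop k}\right\rangle}{z_\mu}\,p_\mu(X),$$ $$F(t,u)=\sum_{i,j\ge0}u^it^j\sum_{k\ge0}\binom{z-k}{i-k}\sum_{\mu\vdash j}(-1)^{k-l(\mu)}\frac{\left\langle{\mu\atop k}\right\rangle}{z_\mu}\,p_\mu(X).$$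
   Context: The letter $\mu$ always denotes an integer partition; $|\mu|$ is the sum of its parts, $\mu\vdash j$ means $|\mu|=j$, $l(\mu)$ is its number of (nonzero) parts, $m_i(\mu)$ the number of parts equal to $i\ge1$, and $z_\mu=\prod_{i\ge1}i^{m_i(\mu)}m_i(\mu)!$ (a number, unrelated to the indeterminate $z$). The generalized binomial coefficient $\left\langle{\mu\atop k}\right\rangle$ (for an integer $k\ge0$) is the number of ways to choose $k$ cells in the Ferrers diagram of $\mu$ with at least one cell chosen in each row (so for the empty partition it is $1$ if $k=0$ and $0$ otherwise). $m_\mu(X)$ is the monomial symmetric function associated with $\mu$; $p_n(X)=\sum_{r\ge1}x_r^n$ and $p_\mu(X)=\prod_r p_{\mu_r}(X)$ (product over the parts of $\mu$). $\binom{a}{n}=a(a-1)\cdots(a-n+1)/n!$ for an integer $n\ge0$ and $\binom{a}{n}=0$ for $n<0$; $(1+u)^z=\sum_{n\ge0}\binom{z}{n}u^n$. The set $X$ may be finite or infinite. *)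

theory Defs
  imports
    "HOL-Analysis.Infinite_Sum"
    "HOL-Computational_Algebra.Polynomial"
    "HOL-Library.Multiset"
    "HOL-Library.Poly_Mapping"
begin

section \<open>Formal power series in arbitrarily many variables\<close>

text \<open>
  Exponent vectors are finitely supported functions \<open>'v \<Rightarrow>\<^sub>0 nat\<close>; a series is an arbitrary
  function from exponent vectors to coefficients.
\<close>

typedef ('v, 'a) mfps = "UNIV :: (('v \<Rightarrow>\<^sub>0 nat) \<Rightarrow> 'a) set"
  morphisms mcoeff Abs_mfps ..

lemma mfps_eqI: "(\<And>m. mcoeff f m = mcoeff g m) \<Longrightarrow> f = g"
  by (metis ext mcoeff_inject)

lemma mcoeff_Abs [simp]: "mcoeff (Abs_mfps h) = h"
  by (simp add: Abs_mfps_inverse)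

definition splits :: "('v \<Rightarrow>\<^sub>0 nat) \<Rightarrow> (('v \<Rightarrow>\<^sub>0 nat) \<times> ('v \<Rightarrow>\<^sub>0 nat)) set"
  where "splits m = {(a, b). a + b = m}"

lemma finite_splits [simp]: "finite (splits m)"
proof -
  define B where "B = {a :: 'a \<Rightarrow>\<^sub>0 nat. \<forall>v. Poly_Mapping.lookup a v \<le> Poly_Mapping.lookup m v}"
  have "Poly_Mapping.lookup ` B \<subseteq> {f. \<forall>v. (v \<in> Poly_Mapping.keys m \<longrightarrow> f v \<in> {..Max (Poly_Mapping.lookup m ` Poly_Mapping.keys m)}) \<and> (v \<notin> Poly_Mapping.keys m \<longrightarrow> f v = 0)}"
  proof (clarsimp simp: B_def, intro conjI impI)
    fix a :: "'a \<Rightarrow>\<^sub>0 nat" and v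
    assume *: "\<forall>v. Poly_Mapping.lookup a v \<le> Poly_Mapping.lookup m v"
    show "Poly_Mapping.lookup a v \<le> Max (Poly_Mapping.lookup m ` Poly_Mapping.keys m)" if "v \<in> Poly_Mapping.keys m"
      using * that by (meson Max_ge finite_imageI finite_keys imageI le_trans)
    show "Poly_Mapping.lookup a v = 0" if "v \<notin> Poly_Mapping.keys m"
      using * that by (metis in_keys_iff le_zero_eq)
  qed
  moreover have "finite {f :: 'a \<Rightarrow> nat. \<forall>v. (v \<in> Poly_Mapping.keys m \<longrightarrow> f v \<in> {..Max (Poly_Mapping.lookup m ` Poly_Mapping.keys m)}) \<and> (v \<notin> Poly_Mapping.keys m \<longrightarrow> f v = 0)}"
    by (rule finite_set_of_finite_funs) auto
  ultimately have "finite (Poly_Mapping.lookup ` B)"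
    by (rule finite_subset)
  then have "finite B"
    by (rule finite_imageD) (simp add: inj_on_def lookup_inject)
  moreover have "splits m \<subseteq> B \<times> B"
    by (auto simp: splits_def B_def lookup_add)
  ultimately show ?thesis
    using finite_subset by blast
qed

instantiation mfps :: (type, comm_ring_1) comm_ring_1
begin

definition "0 = Abs_mfps (\<lambda>_. 0)"
definition "1 = Abs_mfps (\<lambda>m. if m = 0 then 1 else 0)"
definition "f + g = Abs_mfps (\<lambda>m. mcoeff f m + mcoeff g m)"
definition "- f = Abs_mfps (\<lambda>m. - mcoeff f m)"
definition "f - g = Abs_mfps (\<lambda>m. mcoeff f m - mcoeff g m)"
definition "f * g = Abs_mfps (\<lambda>m. \<Sum>(a, b)\<in>splits m. mcoeff f a * mcoeff g b)"

instance
proof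
  fix f g h :: "('a, 'b) mfps"
  show "f * g * h = f * (g * h)"
  proof (rule mfps_eqI)
    fix m
    have "mcoeff (f * g * h) m =
        (\<Sum>(p, c)\<in>splits m. \<Sum>(a, b)\<in>splits p. mcoeff f a * mcoeff g b * mcoeff h c)"
      by (simp add: times_mfps_def sum_distrib_right case_prod_unfold)
    also have "\<dots> = (\<Sum>(x, y)\<in>Sigma (splits m) (\<lambda>x. splits (fst x)).
                      mcoeff f (fst y) * mcoeff g (snd y) * mcoeff h (snd x))"
      by (simp add: sum.Sigma case_prod_unfold)
    also have "\<dots> = (\<Sum>(x, y)\<in>Sigma (splits m) (\<lambda>x. splits (snd x)).
                      mcoeff f (fst x) * mcoeff g (fst y) * mcoeff h (snd y))"
      by (rule sum.reindex_bij_witness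
            [where i = "\<lambda>((a, q), (b, c)). ((a + b, c), (a, b))"
               and j = "\<lambda>((p, c), (a, b)). ((a, b + c), (b, c))"])
         (auto simp: splits_def add.assoc)
    also have "\<dots> = (\<Sum>(a, q)\<in>splits m. \<Sum>(b, c)\<in>splits q. mcoeff f a * (mcoeff g b * mcoeff h c))"
      by (simp add: sum.Sigma case_prod_unfold mult.assoc)
    also have "\<dots> = mcoeff (f * (g * h)) m"
      by (simp add: times_mfps_def sum_distrib_left case_prod_unfold)
    finally show "mcoeff (f * g * h) m = mcoeff (f * (g * h)) m" .
  qed
  show "f * g = g * f"
  proof (rule mfps_eqI)
    fix m
    show "mcoeff (f * g) m = mcoeff (g * f) m"
      unfolding times_mfps_def mcoeff_Abs
      by (rule sum.reindex_bij_witness[where i = prod.swap and j = prod.swap])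
         (auto simp: splits_def add.commute mult.commute)
  qed
  show "1 * f = f"
  proof (rule mfps_eqI)
    fix m
    have "(\<Sum>(a, b)\<in>splits m. mcoeff 1 a * mcoeff f b) = (\<Sum>(a, b)\<in>{(0, m)}. mcoeff 1 a * mcoeff f b)"
      by (rule sum.mono_neutral_right) (simp, auto simp: splits_def one_mfps_def split: if_splits)
    then show "mcoeff (1 * f) m = mcoeff f m"
      by (simp add: times_mfps_def one_mfps_def)
  qed
  show "(f + g) * h = f * h + g * h"
    by (rule mfps_eqI)
       (simp add: times_mfps_def plus_mfps_def case_prod_unfold distrib_right sum.distrib)
  show "f + g + h = f + (g + h)" "f + g = g + f" "0 + f = f" "- f + f = 0" "f - g = f + - g"
    by (rule mfps_eqI; simp add: plus_mfps_def uminus_mfps_def minus_mfps_def zero_mfps_def algebra_simps)+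
  have "mcoeff (0 :: ('a, 'b) mfps) 0 \<noteq> mcoeff 1 0"
    by (simp add: zero_mfps_def one_mfps_def)
  then show "(0 :: ('a, 'b) mfps) \<noteq> 1"
    by metis
qed

end

text \<open>Inverses of units; the value at non-units is the dummy 0.\<close>

instantiation mfps :: (type, comm_ring_1) inverse
begin

definition "inverse (f :: ('a, 'b) mfps) = (if f dvd 1 then THE g. f * g = 1 else 0)"
definition "f div (g :: ('a, 'b) mfps) = f * inverse g"

instance ..

end

lemma mfps_inverse_eqI:
  fixes f g :: "('v, 'a :: comm_ring_1) mfps"
  assumes "f * g = 1"
  shows "inverse f = g"
proof -
  have uniq: "h = g" if "f * h = 1" for h
  proof -
    have "h = f * g * h"
      by (simp add: assms)
    also have "\<dots> = f * h * g"
      by (simp only: mult.assoc mult.commute[of g h])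
    finally show ?thesis
      by (simp add: that)
  qed
  have "f dvd 1"
    unfolding assms[symmetric] by (rule dvd_triv_left)
  moreover have "(THE g. f * g = 1) = g"
    using assms uniq by (rule the_equality)
  ultimately show ?thesis
    by (simp only: inverse_mfps_def if_True)
qed

text \<open>
  Topology of coefficientwise stabilisation, i.e. the product topology with discrete coefficients.
\<close>

instantiation mfps :: (type, type) t2_space
begin

definition "open (S :: ('a, 'b) mfps set) \<longleftrightarrow>
  (\<forall>f\<in>S. \<exists>M. finite M \<and> (\<forall>g. (\<forall>m\<in>M. mcoeff g m = mcoeff f m) \<longrightarrow> g \<in> S))"

instance
proof
  show "open (UNIV :: ('a, 'b) mfps set)"
    unfolding open_mfps_def by (intro ballI exI[of _ "{}"]) simp
next
  fix S T :: "('a, 'b) mfps set"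
  assume S: "open S" and T: "open T"
  show "open (S \<inter> T)"
    unfolding open_mfps_def
  proof
    fix f assume f: "f \<in> S \<inter> T"
    obtain M where "finite M" "\<forall>g. (\<forall>m\<in>M. mcoeff g m = mcoeff f m) \<longrightarrow> g \<in> S"
      using S[unfolded open_mfps_def, rule_format, OF IntD1[OF f]] by blast
    moreover obtain N where "finite N" "\<forall>g. (\<forall>m\<in>N. mcoeff g m = mcoeff f m) \<longrightarrow> g \<in> T"
      using T[unfolded open_mfps_def, rule_format, OF IntD2[OF f]] by blast
    ultimately show "\<exists>M. finite M \<and> (\<forall>g. (\<forall>m\<in>M. mcoeff g m = mcoeff f m) \<longrightarrow> g \<in> S \<inter> T)"
      by (intro exI[of _ "M \<union> N"]) auto
  qed
next
  fix K :: "('a, 'b) mfps set set"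
  assume K: "\<forall>S\<in>K. open S"
  show "open (\<Union>K)"
    unfolding open_mfps_def
  proof
    fix f assume "f \<in> \<Union>K"
    then obtain S where "S \<in> K" "f \<in> S" by blast
    then obtain M where "finite M" "\<forall>g. (\<forall>m\<in>M. mcoeff g m = mcoeff f m) \<longrightarrow> g \<in> S"
      using K[rule_format, OF \<open>S \<in> K\<close>, unfolded open_mfps_def] by blast
    with \<open>S \<in> K\<close> show "\<exists>M. finite M \<and> (\<forall>g. (\<forall>m\<in>M. mcoeff g m = mcoeff f m) \<longrightarrow> g \<in> \<Union>K)"
      by blast
  qed
next
  fix f g :: "('a, 'b) mfps"
  assume "f \<noteq> g"
  then obtain m where m: "mcoeff f m \<noteq> mcoeff g m"
    using mfps_eqI by blast
  have op: "open {h. mcoeff h m = c}" for c :: 'b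
    unfolding open_mfps_def by (auto intro!: exI[of _ "{m}"])
  show "\<exists>U V. open U \<and> open V \<and> f \<in> U \<and> g \<in> V \<and> U \<inter> V = {}"
    using m by (intro exI[of _ "{h. mcoeff h m = mcoeff f m}"] exI[of _ "{h. mcoeff h m = mcoeff g m}"])
               (auto simp: op)
qed

end

lemma tendsto_mfps_iff:
  fixes f :: "'i \<Rightarrow> ('v, 'a) mfps"
  shows "(f \<longlongrightarrow> l) F \<longleftrightarrow> (\<forall>m. \<forall>\<^sub>F i in F. mcoeff (f i) m = mcoeff l m)"
proof
  assume lim: "(f \<longlongrightarrow> l) F"
  show "\<forall>m. \<forall>\<^sub>F i in F. mcoeff (f i) m = mcoeff l m"
  proof
    fix m
    have "open {h. mcoeff h m = mcoeff l m}"
      unfolding open_mfps_def by (auto intro!: exI[of _ "{m}"])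
    from topological_tendstoD[OF lim this] show "\<forall>\<^sub>F i in F. mcoeff (f i) m = mcoeff l m"
      by simp
  qed
next
  assume *: "\<forall>m. \<forall>\<^sub>F i in F. mcoeff (f i) m = mcoeff l m"
  show "(f \<longlongrightarrow> l) F"
  proof (rule topological_tendstoI)
    fix S assume "open S" "l \<in> S"
    then obtain M where M: "finite M" "\<forall>g. (\<forall>m\<in>M. mcoeff g m = mcoeff l m) \<longrightarrow> g \<in> S"
      unfolding open_mfps_def by blast
    have "\<forall>\<^sub>F i in F. \<forall>m\<in>M. mcoeff (f i) m = mcoeff l m"
      using M(1) * by (simp add: eventually_ball_finite)
    then show "\<forall>\<^sub>F i in F. f i \<in> S"
      by (rule eventually_mono) (use M(2) in blast)
  qed
qed

definition infprod :: "('i \<Rightarrow> 'b :: {comm_monoid_mult, t2_space}) \<Rightarrow> 'i set \<Rightarrow> 'b"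
  where "infprod f A = Lim (finite_subsets_at_top A) (prod f)"

definition mconst :: "'a :: zero \<Rightarrow> ('v, 'a) mfps"
  where "mconst c = Abs_mfps (\<lambda>m. if m = 0 then c else 0)"

definition mvar :: "'v \<Rightarrow> ('v, 'a :: zero_neq_one) mfps"
  where "mvar v = Abs_mfps (\<lambda>m. if m = Poly_Mapping.single v 1 then 1 else 0)"


section \<open>The series ring $K[z][[t,u,x_0,x_1,\ldots]]$\<close>

datatype var = Var_t | Var_u | Var_x nat

type_synonym 'k series = "(var, 'k poly) mfps"

abbreviation t_var :: "'k :: field_char_0 series" where "t_var \<equiv> mvar Var_t"
abbreviation u_var :: "'k :: field_char_0 series" where "u_var \<equiv> mvar Var_u"
abbreviation x_var :: "nat \<Rightarrow> 'k :: field_char_0 series" where "x_var r \<equiv> mvar (Var_x r)"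
abbreviation z_var :: "'k :: field_char_0 poly" where "z_var \<equiv> [:0, 1:]"

definition binom :: "'k :: field_char_0 poly \<Rightarrow> int \<Rightarrow> 'k poly"
  where "binom a n = (if n < 0 then 0 else smult (1 / fact (nat n)) (\<Prod>i<nat n. a - of_nat i))"


section \<open>Integer partitions\<close>

text \<open>A partition is the multiset of its parts; the number of parts is \<open>size\<close>.\<close>

definition partitions :: "nat \<Rightarrow> nat multiset set"
  where "partitions j = {\<mu>. 0 \<notin># \<mu> \<and> sum_mset \<mu> = j}"

definition z_part :: "nat multiset \<Rightarrow> nat"
  where "z_part \<mu> = (\<Prod>i\<in>set_mset \<mu>. i ^ count \<mu> i * fact (count \<mu> i))"

definition ferrers :: "nat multiset \<Rightarrow> (nat \<times> nat) set"
  where "ferrers \<mu> = {(r, c). r < size \<mu> \<and> c < rev (sorted_list_of_multiset \<mu>) ! r}"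

definition partition_binom :: "nat multiset \<Rightarrow> nat \<Rightarrow> nat"
  where "partition_binom \<mu> k =
    card {S. S \<subseteq> ferrers \<mu> \<and> card S = k \<and> (\<forall>r<size \<mu>. \<exists>c. (r, c) \<in> S)}"

lemma finite_ferrers: "finite (ferrers \<mu>)"
proof -
  have "ferrers \<mu> = Sigma {..<size \<mu>} (\<lambda>r. {..<rev (sorted_list_of_multiset \<mu>) ! r})"
    by (auto simp: ferrers_def)
  then show ?thesis
    by simp
qed

lemma finite_partitions: "finite (partitions j)"
proof -
  have "\<mu> \<in> mset ` {xs. set xs \<subseteq> {..j} \<and> length xs \<le> j}" if "\<mu> \<in> partitions j" for \<mu>
  proof -
    obtain xs where xs: "\<mu> = mset xs"
      by (metis ex_mset)
    have sum: "sum_list xs = j" and pos: "0 \<notin> set xs"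
      using that by (auto simp: partitions_def xs sum_mset_sum_list)
    have "length xs \<le> sum_list xs"
      using pos by (induction xs) auto
    moreover have "set xs \<subseteq> {..j}"
      using sum member_le_sum_list by fastforce
    ultimately show ?thesis
      using sum xs by auto
  qed
  then have "partitions j \<subseteq> mset ` {xs. set xs \<subseteq> {..j} \<and> length xs \<le> j}"
    by blast
  then show ?thesis
    by (rule finite_subset) (simp add: finite_lists_length_le)
qed


section \<open>Symmetric functions of $X = \{x_r \mid r \in I\}$\<close>

text \<open>The sum of all distinct monomials in $X$ whose nonzero exponents form the partition \<open>\<mu>\<close>.\<close>

definition m_sym :: "nat set \<Rightarrow> nat multiset \<Rightarrow> 'k :: field_char_0 series"
  where "m_sym I \<mu> = Abs_mfps (\<lambda>a.
    if Poly_Mapping.keys a \<subseteq> Var_x ` I \<and>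
       image_mset (Poly_Mapping.lookup a) (mset_set (Poly_Mapping.keys a)) = \<mu>
    then 1 else 0)"

definition power_sum :: "nat set \<Rightarrow> nat \<Rightarrow> 'k :: field_char_0 series"
  where "power_sum I n = (\<Sum>\<^sub>\<infinity>r\<in>I. x_var r ^ n)"

definition p_sym :: "nat set \<Rightarrow> nat multiset \<Rightarrow> 'k :: field_char_0 series"
  where "p_sym I \<mu> = (\<Prod>n\<in>#\<mu>. power_sum I n)"


section \<open>The series $F(t,u)$\<close>

definition one_plus_u_pow_z :: "'k :: field_char_0 series"
  where "one_plus_u_pow_z = (\<Sum>\<^sub>\<infinity>n. mconst (binom z_var (int n)) * u_var ^ n)"

definition F_series :: "nat set \<Rightarrow> 'k :: field_char_0 series"
  where "F_series I = one_plus_u_pow_z *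
    infprod (\<lambda>r. 1 + u_var / (1 + u_var) * (t_var * x_var r / (1 - t_var * x_var r))) I"

text \<open>Scalars of the ground field, inside the series ring.\<close>

abbreviation scalar :: "'k :: field_char_0 \<Rightarrow> 'k series"
  where "scalar c \<equiv> mconst [:c:]"

end

theory Submission
  imports Defs "HOL-Computational_Algebra.Formal_Power_Series"
begin

text \<open>
  All three expansions are checked on the coefficient of a single monomial \<open>u\<^sup>i t\<^sup>j x\<^sup>a\<close>. Expanding
  \<open>t x\<^sub>r/(1 - t x\<^sub>r)\<close> as a geometric series, a monomial \<open>x\<^sup>a\<close> of degree \<open>j\<close> in \<open>l\<close> variables has coefficient
  \<open>t\<^sup>j (1 + u)\<^sup>z (u/(1+u))\<^sup>l = t\<^sup>j u\<^sup>l (1 + u)\<^sup>z\<^sup>-\<^sup>l\<close> in \<open>F\<close>, which gives the binomial coefficient of \<open>z - l\<close> over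
  \<open>i - l\<close>. This is \<open>F_series_eq\<close>; since a monomial lies in exactly one \<open>m\<^sub>\<mu>\<close>, and then \<open>l = l(\<mu>)\<close>, it is
  already the first expansion.

  For the other two, put \<open>y = 1/(1+u)\<close>. The factor of \<open>r\<close> in \<open>F\<close> is \<open>(1 - y t x\<^sub>r)/(1 - t x\<^sub>r)\<close>, whose logarithm
  is \<open>\<Sum>\<^sub>n (1 - y\<^sup>n) t\<^sup>n x\<^sub>r\<^sup>n / n\<close>; so the product is \<open>\<Sum>\<^sub>\<mu> t\<^bsup>|\<mu>|\<^esup> p\<^sub>\<mu>/z\<^sub>\<mu> \<Prod>(1 - y\<^sup>n)\<close>, where \<open>n\<close> runs through the
  parts of \<open>\<mu>\<close>. The proof of this identity (\<open>cycle_index_mcoeff\<close>) avoids logarithms and exponentials: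
  both sides satisfy the recursion \<open>j T\<^sub>j = \<Sum>\<^sub>n (1 - y\<^sup>n) p\<^sub>n T\<^sub>j\<^sub>-\<^sub>n\<close>, by \<open>sum_partitions_recursion\<close> and by
  \<open>one_variable_recursion\<close>.

  Finally \<open>\<Prod>((1 + v)\<^sup>n - 1)\<close> is the generating polynomial of the generalized binomial coefficients of
  \<open>\<mu>\<close> (\<open>partition_binom_gf\<close>). Writing \<open>1 - y\<^sup>n\<close> as \<open>y\<^sup>n ((1 + u)\<^sup>n - 1)\<close> gives the second expansion, and
  writing it as \<open>-((1 - u/(1+u))\<^sup>n - 1)\<close> gives the third. Polynomials in \<open>z\<close> are compared by evaluation at
  every \<open>c\<close> in the ground field, which turns these computations into computations with power series in
  \<open>u\<close> over that field.
\<close>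

section \<open>Coefficients of monomial multiples\<close>

lemma mcoeff_simps [simp]:
  "mcoeff (f + g) m = mcoeff f m + mcoeff g m"
  "mcoeff (f - g) m = mcoeff f m - mcoeff g m"
  "mcoeff 0 m = 0"
  "mcoeff 1 m = (if m = 0 then 1 else 0)"
  for f g :: "('v, 'a :: comm_ring_1) mfps"
  by (simp_all add: plus_mfps_def minus_mfps_def zero_mfps_def one_mfps_def)

lemma mcoeff_sum [simp]:
  "mcoeff (\<Sum>x\<in>A. f x) m = (\<Sum>x\<in>A. mcoeff (f x) m)"
  for f :: "'i \<Rightarrow> ('v, 'a :: comm_ring_1) mfps"
  by (induction A rule: infinite_finite_induct) simp_all

definition mmonom :: "'a :: zero \<Rightarrow> ('v \<Rightarrow>\<^sub>0 nat) \<Rightarrow> ('v, 'a) mfps"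
  where "mmonom c e = Abs_mfps (\<lambda>m. if m = e then c else 0)"

lemma mcoeff_mmonom [simp]: "mcoeff (mmonom c e) m = (if m = e then c else 0)"
  by (simp add: mmonom_def)

text \<open>The condition says that \<open>e\<close> divides \<open>m\<close>, since subtraction of exponents is truncated.\<close>

lemma mcoeff_mmonom_mult:
  fixes f :: "('v, 'a :: comm_ring_1) mfps"
  shows "mcoeff (mmonom c e * f) m = (if e + (m - e) = m then c * mcoeff f (m - e) else 0)"
proof -
  have "mcoeff (mmonom c e * f) m =
      (\<Sum>p\<in>splits m. if p = (e, m - e) then c * mcoeff f (m - e) else 0)"
    by (auto simp: times_mfps_def splits_def intro!: sum.cong)
  also have "\<dots> = (if e + (m - e) = m then c * mcoeff f (m - e) else 0)"
    using sum.delta[OF finite_splits[of m], of "(e, m - e)" "\<lambda>_. c * mcoeff f (m - e)"]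
    by (simp add: splits_def eq_commute[of m])
  finally show ?thesis .
qed

lemma mmonom_mult_mmonom:
  "mmonom c e * mmonom d e' = mmonom (c * d) (e + e')" for c :: "'a :: comm_ring_1"
  by (rule mfps_eqI) (auto simp: mcoeff_mmonom_mult)

lemma mconst_eq_mmonom: "mconst c = mmonom c 0"
  by (simp add: mconst_def mmonom_def)

lemma mcoeff_mconst_mult [simp]: "mcoeff (mconst c * f) m = c * mcoeff f m"
  for c :: "'a :: comm_ring_1"
  by (simp add: mconst_eq_mmonom mcoeff_mmonom_mult)

lemma mvar_power_eq_mmonom:
  "mvar v ^ n = mmonom (1 :: 'a :: comm_ring_1) (Poly_Mapping.single v n)"
proof (induction n)
  case 0
  show ?case by (rule mfps_eqI) simp
next
  case (Suc n)
  have "mvar v = mmonom (1 :: 'a) (Poly_Mapping.single v 1)"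
    by (simp add: mvar_def mmonom_def)
  with Suc show ?case
    by (simp add: mmonom_mult_mmonom flip: single_add)
qed

lemma mvar_eq_mmonom: "mvar v = mmonom (1 :: 'a :: comm_ring_1) (Poly_Mapping.single v 1)"
  using mvar_power_eq_mmonom[of v 1] by simp

section \<open>Coefficientwise convergence\<close>

text \<open>
  In the binomial series, in the power sums and in the double sums over \<open>i\<close> and \<open>j\<close>, an exponent vector
  \<open>m\<close> can occur in at most one summand, and \<open>h m\<close> is the index of that summand; it may fall
  outside \<open>A\<close>.
\<close>

lemma has_sum_mfpsI:
  fixes f :: "'i \<Rightarrow> ('v, 'a :: comm_ring_1) mfps"
  assumes "\<And>m x. x \<in> A \<Longrightarrow> x \<noteq> h m \<Longrightarrow> mcoeff (f x) m = 0"
    and "\<And>m. mcoeff s m = (if h m \<in> A then mcoeff (f (h m)) m else 0)"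
  shows "(f has_sum s) A"
  unfolding has_sum_def tendsto_mfps_iff eventually_finite_subsets_at_top
proof (intro allI exI conjI impI; (elim conjE)?)
  fix m Y assume Y: "finite Y" "{h m} \<inter> A \<subseteq> Y" "Y \<subseteq> A"
  have "mcoeff (sum f Y) m = (\<Sum>x\<in>Y. if x = h m then mcoeff (f (h m)) m else 0)"
    unfolding mcoeff_sum by (rule sum.cong) (use assms(1) Y in auto)
  also have "\<dots> = mcoeff s m"
    using Y by (auto simp: assms(2))
  finally show "mcoeff (sum f Y) m = mcoeff s m" .
qed auto

lemma tendsto_mult_left_mfps:
  fixes f :: "'i \<Rightarrow> ('v, 'a :: comm_ring_1) mfps"
  assumes "(f \<longlongrightarrow> l) F"
  shows "((\<lambda>i. g * f i) \<longlongrightarrow> g * l) F"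
  unfolding tendsto_mfps_iff
proof
  fix m
  have "\<forall>\<^sub>F i in F. \<forall>p\<in>splits m. mcoeff (f i) (snd p) = mcoeff l (snd p)"
    using assms by (simp add: eventually_ball_finite tendsto_mfps_iff)
  then show "\<forall>\<^sub>F i in F. mcoeff (g * f i) m = mcoeff (g * l) m"
    by (rule eventually_mono) (auto simp: times_mfps_def intro!: sum.cong)
qed

section \<open>The coefficients of $F(t,u)$\<close>

definition xvars :: "(var \<Rightarrow>\<^sub>0 nat) \<Rightarrow> nat set"
  where "xvars m = {r. Poly_Mapping.lookup m (Var_x r) \<noteq> 0}"

definition xdeg :: "(var \<Rightarrow>\<^sub>0 nat) \<Rightarrow> nat"
  where "xdeg m = (\<Sum>r\<in>xvars m. Poly_Mapping.lookup m (Var_x r))"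

lemma finite_xvars [simp]: "finite (xvars m)"
proof (rule finite_imageD)
  have "Var_x ` xvars m \<subseteq> Poly_Mapping.keys m"
    by (auto simp: xvars_def in_keys_iff)
  then show "finite (Var_x ` xvars m)"
    by (rule finite_subset) simp
qed (simp add: inj_on_def)

lemma xdeg_eq: "finite R \<Longrightarrow> xvars m \<subseteq> R \<Longrightarrow> xdeg m = (\<Sum>r\<in>R. Poly_Mapping.lookup m (Var_x r))"
  unfolding xdeg_def by (rule sum.mono_neutral_left) (auto simp: xvars_def)

lemma xvars_add: "xvars (m + m') = xvars m \<union> xvars m'"
  by (auto simp: xvars_def lookup_add)

lemma xvars_single [simp]:
  "xvars 0 = {}"
  "xvars (Poly_Mapping.single Var_t n) = {}"
  "xvars (Poly_Mapping.single Var_u n) = {}"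
  "xvars (Poly_Mapping.single (Var_x r) n) = (if n = 0 then {} else {r})"
  by (auto simp: xvars_def lookup_single when_def)

lemma xdeg_add: "xdeg (m + m') = xdeg m + xdeg m'"
  by (subst (1 2 3) xdeg_eq[of "xvars m \<union> xvars m'"])
     (auto simp: xvars_add lookup_add sum.distrib)

lemma xdeg_single [simp]:
  "xdeg (Poly_Mapping.single Var_t n) = 0"
  "xdeg (Poly_Mapping.single Var_u n) = 0"
  "xdeg (Poly_Mapping.single (Var_x r) n) = n"
  by (auto simp: xdeg_def)

lemma xdeg_zero_iff: "xdeg m = 0 \<longleftrightarrow> xvars m = {}"
proof -
  have "xdeg m = 0 \<longleftrightarrow> (\<forall>r\<in>xvars m. Poly_Mapping.lookup m (Var_x r) = 0)"
    by (simp add: xdeg_def)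
  then show ?thesis
    by (auto simp: xvars_def)
qed

lemma poly_binom: "poly (binom w n) c = (if n < 0 then 0 else poly w c gchoose nat n)"
  by (simp add: binom_def gbinomial_prod_rev poly_prod atLeast0LessThan)

lemma poly_eqI_eval: "(\<And>c. poly p c = poly q c) \<Longrightarrow> p = q" for p q :: "'k :: field_char_0 poly"
  by (meson ext poly_eq_poly_eq_iff)

lemma binom_pascal: "binom (w + 1) n = binom w n + binom w (n - 1)"
proof (rule poly_eqI_eval)
  fix c
  consider "n < 0" | "n = 0" | k where "n = int (Suc k)"
    by (metis not_less_iff_gr_or_eq zero_less_imp_eq_int gr0_conv_Suc)
  then show "poly (binom (w + 1) n) c = poly (binom w n + binom w (n - 1)) c"
    by cases (simp_all add: poly_binom gbinomial_Suc_Suc nat_add_distrib)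
qed

text \<open>
  The closed form of \<open>(1 + u)\<^sup>c \<Prod>\<^sub>r\<^sub>\<in>\<^sub>J (1 + u/(1+u) \<cdot> t x\<^sub>r/(1 - t x\<^sub>r))\<close>: a monomial in \<open>l\<close> of the variables
  contributes \<open>(1 + u)\<^sup>c (u/(1+u))\<^sup>l = u\<^sup>l (1 + u)\<^sup>c\<^sup>-\<^sup>l\<close>. The exponent \<open>c\<close> is left free because multiplication
  by \<open>1 + u\<close> raises it by one, and because \<open>c = 0\<close> gives the product alone, \<open>c = -1\<close> and \<open>J = {}\<close> the
  inverse of \<open>1 + u\<close>.
\<close>

definition F_closed :: "'k :: field_char_0 poly \<Rightarrow> nat set \<Rightarrow> 'k series"
  where "F_closed c J = Abs_mfps (\<lambda>m.
    if xvars m \<subseteq> J \<and> xdeg m = Poly_Mapping.lookup m Var_t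
    then binom (c - of_nat (card (xvars m)))
           (int (Poly_Mapping.lookup m Var_u) - int (card (xvars m)))
    else 0)"

lemma mcoeff_F_closed:
  "mcoeff (F_closed c J) m = (if xvars m \<subseteq> J \<and> xdeg m = Poly_Mapping.lookup m Var_t
    then binom (c - of_nat (card (xvars m)))
           (int (Poly_Mapping.lookup m Var_u) - int (card (xvars m)))
    else 0)"
  by (simp add: F_closed_def)

lemma single_divides_iff:
  "Poly_Mapping.single v n + (m - Poly_Mapping.single v n) = m \<longleftrightarrow> n \<le> Poly_Mapping.lookup m v"
  for m :: "'v \<Rightarrow>\<^sub>0 nat"
proof
  assume "Poly_Mapping.single v n + (m - Poly_Mapping.single v n) = m"
  from arg_cong[OF this, of "\<lambda>p. Poly_Mapping.lookup p v"]
  show "n \<le> Poly_Mapping.lookup m v"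
    by (simp add: lookup_add lookup_minus)
qed (auto intro!: poly_mapping_eqI simp: lookup_add lookup_minus lookup_single when_def)

lemma binom_neg [simp]: "n < 0 \<Longrightarrow> binom c n = 0"
  by (simp add: binom_def)

lemma F_closed_step_u: "(1 + u_var) * F_closed c J = F_closed (c + 1) J"
proof (rule mfps_eqI)
  fix m
  have *: "mcoeff ((1 + u_var) * F_closed c J) m = mcoeff (F_closed c J) m +
    (if 1 \<le> Poly_Mapping.lookup m Var_u then mcoeff (F_closed c J) (m - Poly_Mapping.single Var_u 1) else 0)"
    by (simp add: distrib_right mvar_eq_mmonom mcoeff_mmonom_mult single_divides_iff)
  show "mcoeff ((1 + u_var) * F_closed c J) m = mcoeff (F_closed (c + 1) J) m"
  proof (cases "1 \<le> Poly_Mapping.lookup m Var_u")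
    case True
    then obtain m' where m: "m = Poly_Mapping.single Var_u 1 + m'"
      using single_divides_iff by metis
    show ?thesis
      unfolding * using binom_pascal[of "c - of_nat (card (xvars m))" "int (Poly_Mapping.lookup m Var_u) - int (card (xvars m))"]
      by (simp add: m mcoeff_F_closed xvars_add xdeg_add lookup_add lookup_single algebra_simps)
  next
    case False
    show ?thesis
      unfolding * using False binom_pascal[of "c - of_nat (card (xvars m))" "int (Poly_Mapping.lookup m Var_u) - int (card (xvars m))"]
      by (simp add: mcoeff_F_closed algebra_simps)
  qed
qed

text \<open>
  Division-free form of the effect of one more variable: with \<open>(1 + u) F\<^sub>c = F\<^sub>c\<^sub>+\<^sub>1\<close>, it says that
  multiplying by \<open>(1 + u)(1 - t x\<^sub>r)\<close> turns the series for \<open>J \<union> {r}\<close> into \<open>1 + u - t x\<^sub>r\<close> times the series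
  for \<open>J\<close>. At exponent 1 of \<open>x\<^sub>r\<close> this is the Pascal rule; at higher exponents the two
  coefficients of the series for \<open>J \<union> {r}\<close> cancel.
\<close>

lemma F_closed_step_x:
  assumes "r \<notin> J"
  shows "(1 - t_var * x_var r) * F_closed (c + 1) (insert r J) + t_var * x_var r * F_closed c J
    = F_closed (c + 1) J"
proof (rule mfps_eqI)
  fix m
  define e where "e = Poly_Mapping.single Var_t 1 + Poly_Mapping.single (Var_x r) (1::nat)"
  have tx: "t_var * x_var r = mmonom 1 e"
    by (simp add: mvar_eq_mmonom mmonom_mult_mmonom e_def)
  let ?L = "(1 - t_var * x_var r) * F_closed (c + 1) (insert r J) + t_var * x_var r * F_closed c J"
  show "mcoeff ?L m = mcoeff (F_closed (c + 1) J) m"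
  proof (cases "e + (m - e) = m")
    case True
    then obtain m' where m: "m = e + m'" by metis
    have L: "mcoeff ?L m = mcoeff (F_closed (c + 1) (insert r J)) m
        - mcoeff (F_closed (c + 1) (insert r J)) m' + mcoeff (F_closed c J) m'"
      unfolding tx by (simp add: m mcoeff_mmonom_mult left_diff_distrib)
    have R: "mcoeff (F_closed (c + 1) J) m = 0"
      using assms by (simp add: mcoeff_F_closed m e_def xvars_add)
    show ?thesis
    proof (cases "r \<in> xvars m'")
      case True
      then have "xvars m = xvars m'"
        by (auto simp: m e_def xvars_add)
      then show ?thesis
        unfolding L R using True assms
        by (auto simp: mcoeff_F_closed m e_def xdeg_add lookup_add lookup_single)
    next
      case False
      then have "card (xvars m) = card (xvars m') + 1"
        by (simp add: m e_def xvars_add)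
      moreover have "xvars m \<subseteq> insert r J \<longleftrightarrow> xvars m' \<subseteq> J" "xvars m' \<subseteq> insert r J \<longleftrightarrow> xvars m' \<subseteq> J"
        using False by (auto simp: m e_def xvars_add)
      moreover have "xdeg m = xdeg m' + 1" "Poly_Mapping.lookup m Var_t = Poly_Mapping.lookup m' Var_t + 1"
        "Poly_Mapping.lookup m Var_u = Poly_Mapping.lookup m' Var_u"
        by (simp_all add: m e_def xdeg_add lookup_add lookup_single)
      ultimately show ?thesis
        unfolding L R
        using binom_pascal[of "c - of_nat (card (xvars m'))" "int (Poly_Mapping.lookup m' Var_u) - int (card (xvars m'))"]
        by (simp add: mcoeff_F_closed algebra_simps)
    qed
  next
    case False
    then have L: "mcoeff ?L m = mcoeff (F_closed (c + 1) (insert r J)) m"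
      unfolding tx by (simp add: mcoeff_mmonom_mult left_diff_distrib)
    have "Poly_Mapping.lookup m Var_t = 0 \<or> Poly_Mapping.lookup m (Var_x r) = 0"
    proof (rule ccontr)
      assume "\<not> ?thesis"
      then have "e + (m - e) = m"
        by (intro poly_mapping_eqI) (auto simp: e_def lookup_add lookup_minus lookup_single when_def)
      with False show False ..
    qed
    then show ?thesis
    proof
      assume t: "Poly_Mapping.lookup m Var_t = 0"
      show ?thesis
        unfolding L by (auto simp: mcoeff_F_closed t xdeg_zero_iff)
    next
      assume "Poly_Mapping.lookup m (Var_x r) = 0"
      then have "xvars m \<subseteq> insert r J \<longleftrightarrow> xvars m \<subseteq> J"
        by (auto simp: xvars_def)
      then show ?thesis
        unfolding L by (simp add: mcoeff_F_closed)
    qed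
  qed
qed

lemma F_closed_0_empty: "F_closed 0 {} = 1"
proof (rule mfps_eqI)
  fix m :: "var \<Rightarrow>\<^sub>0 nat"
  have b: "binom (0 :: 'a poly) n = (if n = 0 then 1 else 0)" for n
    by (rule poly_eqI_eval) (simp add: poly_binom gbinomial_0_left)
  have "m = 0" if "xvars m = {}" "Poly_Mapping.lookup m Var_t = 0" "Poly_Mapping.lookup m Var_u = 0"
  proof (rule poly_mapping_eqI)
    fix v show "Poly_Mapping.lookup m v = Poly_Mapping.lookup 0 v"
      using that by (cases v) (auto simp: xvars_def)
  qed
  then show "mcoeff (F_closed 0 {} :: 'a series) m = mcoeff 1 m"
    by (auto simp: mcoeff_F_closed b xdeg_zero_iff[THEN iffD2])
qed

lemma mult_inverse_one_plus_u: "(1 + u_var) * inverse (1 + u_var) = (1 :: 'k :: field_char_0 series)"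
proof -
  have "(1 + u_var) * F_closed (-1) {} = (1 :: 'k series)"
    using F_closed_step_u[of "-1" "{}"] by (simp add: F_closed_0_empty)
  then show ?thesis
    by (simp add: mfps_inverse_eqI)
qed

lemma mult_inverse_one_minus_tx:
  "(1 - t_var * x_var r) * inverse (1 - t_var * x_var r) = (1 :: 'k :: field_char_0 series)"
proof -
  define e where "e = Poly_Mapping.single Var_t 1 + Poly_Mapping.single (Var_x r) (1::nat)"
  have tx: "t_var * x_var r = (mmonom 1 e :: 'k series)"
    by (simp add: mvar_eq_mmonom mmonom_mult_mmonom e_def)
  define E where "E n = Poly_Mapping.single Var_t n + Poly_Mapping.single (Var_x r) n" for n :: nat
  have E: "E 0 = 0" "E (Suc n) = e + E n" for n
    by (simp_all add: E_def e_def ac_simps single_add[of _ n "Suc 0", simplified])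
  \<comment> \<open>The geometric series in \<open>t x\<^sub>r\<close>, whose monomials are \<open>E n = n e\<close>.\<close>
  define g :: "'k series" where "g = Abs_mfps (\<lambda>m. if m \<in> range E then 1 else 0)"
  have "(1 - mmonom 1 e) * g = 1"
  proof (rule mfps_eqI)
    fix m
    have L: "mcoeff ((1 - mmonom 1 e) * g) m =
        (if m \<in> range E then 1 else 0) - (if e + (m - e) = m \<and> m - e \<in> range E then 1 else 0)"
      by (simp add: g_def left_diff_distrib mcoeff_mmonom_mult)
    have "m \<in> range E \<longleftrightarrow> m = 0 \<or> e + (m - e) = m \<and> m - e \<in> range E"
    proof
      assume "m \<in> range E"
      then obtain n where "m = E n" by blast
      then show "m = 0 \<or> e + (m - e) = m \<and> m - e \<in> range E"
        by (cases n) (auto simp: E)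
    next
      assume "m = 0 \<or> e + (m - e) = m \<and> m - e \<in> range E"
      then show "m \<in> range E"
        by (metis E rangeE rangeI)
    qed
    moreover have "e + (0 - e) \<noteq> 0"
    proof
      assume "e + (0 - e) = 0"
      from arg_cong[OF this, of "\<lambda>p. Poly_Mapping.lookup p Var_t"] show False
        by (simp add: e_def lookup_add lookup_minus lookup_single)
    qed
    ultimately show "mcoeff ((1 - mmonom 1 e) * g) m = mcoeff 1 m"
      unfolding L by auto
  qed
  then show ?thesis
    by (simp add: tx mfps_inverse_eqI)
qed

text \<open>
  The factor of \<open>r\<close> equals \<open>(1 + u - t x\<^sub>r) / ((1 + u)(1 - t x\<^sub>r))\<close>, so the two step rules give the claim
  after multiplication by the units \<open>1 + u\<close> and \<open>1 - t x\<^sub>r\<close>.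
\<close>

lemma F_closed_mult_prod:
  assumes "finite J"
  shows "F_closed c {} * (\<Prod>r\<in>J. 1 + u_var / (1 + u_var) * (t_var * x_var r / (1 - t_var * x_var r)))
    = F_closed c J"
  using assms
proof (induction J)
  case empty
  show ?case by simp
next
  case (insert r J)
  let ?a = "1 + u_var :: 'a series" and ?b = "1 - t_var * x_var r :: 'a series"
  let ?f = "1 + u_var / ?a * (t_var * x_var r / ?b)"
  have f: "?a * ?b * ?f = ?a - t_var * x_var r"
  proof -
    have "?a * ?b * ?f = ?a * ?b + u_var * (?a * inverse ?a) * (t_var * x_var r) * (?b * inverse ?b)"
      by (simp add: divide_mfps_def algebra_simps)
    also have "\<dots> = ?a * ?b + u_var * (t_var * x_var r)"
      by (simp only: mult_inverse_one_plus_u mult_inverse_one_minus_tx mult_1_right)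
    finally show ?thesis
      by (simp add: algebra_simps)
  qed
  have "?a * ?b * F_closed c (insert r J) = ?b * (?a * F_closed c (insert r J))"
    by (simp only: mult_ac)
  also have "\<dots> = F_closed (c + 1) J - t_var * x_var r * F_closed c J"
    unfolding F_closed_step_u using F_closed_step_x[OF insert.hyps(2), of c] by (simp add: algebra_simps)
  also have "\<dots> = ?a * ?b * ?f * F_closed c J"
    unfolding f by (simp add: left_diff_distrib F_closed_step_u)
  finally have *: "?a * ?b * F_closed c (insert r J) = ?a * ?b * (?f * F_closed c J)"
    by (simp only: mult.assoc)
  have cancel: "g = h" if "p * q * g = p * q * h" "p * p' = 1" "q * q' = 1" for p q p' q' g h :: "'a series"
  proof -
    have "g = (p * p') * (q * q') * g" "h = (p * p') * (q * q') * h"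
      by (simp_all add: that)
    moreover have "(p * p') * (q * q') * g = p' * q' * (p * q * g)" "(p * p') * (q * q') * h = p' * q' * (p * q * h)"
      by (simp_all only: mult_ac)
    ultimately show ?thesis
      using that(1) by metis
  qed
  have "F_closed c (insert r J) = ?f * F_closed c J"
    by (rule cancel[OF * mult_inverse_one_plus_u mult_inverse_one_minus_tx])
  then show ?case
    by (simp only: prod.insert[OF insert.hyps] insert.IH mult.left_commute[of "F_closed c {}"])
qed

lemma F_closed_tendsto: "(F_closed c \<longlongrightarrow> F_closed c I) (finite_subsets_at_top I)"
  unfolding tendsto_mfps_iff eventually_finite_subsets_at_top
proof (intro allI exI conjI impI; (elim conjE)?)
  fix m Y assume "xvars m \<inter> I \<subseteq> Y" "Y \<subseteq> I"
  then have "xvars m \<subseteq> Y \<longleftrightarrow> xvars m \<subseteq> I" by blast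
  then show "mcoeff (F_closed c Y) m = mcoeff (F_closed c I) m"
    by (simp add: mcoeff_F_closed)
qed auto

lemma one_plus_u_pow_z_eq: "one_plus_u_pow_z = F_closed z_var {}"
  unfolding one_plus_u_pow_z_def
proof (rule infsumI, rule has_sum_mfpsI)
  fix m :: "var \<Rightarrow>\<^sub>0 nat"
  have m: "m = Poly_Mapping.single Var_u (Poly_Mapping.lookup m Var_u)
    \<longleftrightarrow> xvars m = {} \<and> Poly_Mapping.lookup m Var_t = 0"
  proof
    assume "m = Poly_Mapping.single Var_u (Poly_Mapping.lookup m Var_u)"
    then obtain k where "m = Poly_Mapping.single Var_u k" ..
    then show "xvars m = {} \<and> Poly_Mapping.lookup m Var_t = 0"
      by (simp add: lookup_single)
  next
    assume *: "xvars m = {} \<and> Poly_Mapping.lookup m Var_t = 0"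
    show "m = Poly_Mapping.single Var_u (Poly_Mapping.lookup m Var_u)"
    proof (rule poly_mapping_eqI)
      fix v show "Poly_Mapping.lookup m v = Poly_Mapping.lookup (Poly_Mapping.single Var_u (Poly_Mapping.lookup m Var_u)) v"
        using * by (cases v) (auto simp: xvars_def lookup_single)
    qed
  qed
  show "mcoeff (F_closed z_var {}) m = (if Poly_Mapping.lookup m Var_u \<in> UNIV
    then mcoeff (mconst (binom z_var (int (Poly_Mapping.lookup m Var_u))) * u_var ^ Poly_Mapping.lookup m Var_u) m else 0)"
    using m by (auto simp: mcoeff_F_closed mvar_power_eq_mmonom xdeg_zero_iff[THEN iffD2])
next
  fix m and n :: nat
  assume "n \<noteq> Poly_Mapping.lookup m Var_u"
  then have "m \<noteq> Poly_Mapping.single Var_u n" by auto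
  then show "mcoeff (mconst (binom z_var (int n)) * u_var ^ n) m = 0"
    by (simp add: mvar_power_eq_mmonom)
qed

text \<open>
  The product converges by the case \<open>c = 0\<close>, and multiplication by \<open>(1 + u)\<^sup>z\<close> is continuous, so both
  \<open>F\<close> and the closed form are the limit of the finite products.
\<close>

lemma F_series_eq: "F_series I = F_closed z_var I"
proof -
  let ?f = "\<lambda>r. 1 + u_var / (1 + u_var) * (t_var * x_var r / (1 - t_var * x_var r)) :: 'a series"
  have ev: "\<forall>\<^sub>F J in finite_subsets_at_top I. F_closed c J = F_closed c {} * prod ?f J" for c
    using eventually_finite_subsets_at_top_weakI[of I "\<lambda>J. F_closed c J = F_closed c {} * prod ?f J"]
    by (simp only: F_closed_mult_prod)
  have "(prod ?f \<longlongrightarrow> F_closed 0 I) (finite_subsets_at_top I)"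
    using Lim_transform_eventually[OF F_closed_tendsto ev, of 0] by (simp only: F_closed_0_empty mult_1_left)
  then have inf: "infprod ?f I = F_closed 0 I" and lim: "((\<lambda>J. F_closed z_var {} * prod ?f J) \<longlongrightarrow> F_closed z_var {} * F_closed 0 I) (finite_subsets_at_top I)"
    unfolding infprod_def by (auto intro: tendsto_Lim tendsto_mult_left_mfps)
  show ?thesis
    unfolding F_series_def inf one_plus_u_pow_z_eq
    using tendsto_unique[OF _ lim Lim_transform_eventually[OF F_closed_tendsto ev, of z_var]] by simp
qed

text \<open>
  The coefficient of \<open>u\<^sup>i t\<^sup>j x\<^sup>a\<close> in \<open>F\<close>, for an exponent vector \<open>a\<close> of the variables \<open>x\<^sub>r\<close> only. Requiring
  that it vanish when \<open>t\<close> or \<open>u\<close> occurs in \<open>a\<close> makes it comparable with the coefficients of the inner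
  sums of the three expansions, in which \<open>t\<close> and \<open>u\<close> do not occur.
\<close>

definition expansion_coeff :: "nat set \<Rightarrow> nat \<Rightarrow> nat \<Rightarrow> (var \<Rightarrow>\<^sub>0 nat) \<Rightarrow> 'k :: field_char_0 poly"
  where "expansion_coeff I i j a =
    (if Poly_Mapping.keys a \<subseteq> Var_x ` I \<and> xdeg a = j
     then binom (z_var - of_nat (card (xvars a))) (int i - int (card (xvars a))) else 0)"

lemma keys_subset_iff: "Poly_Mapping.keys a \<subseteq> Var_x ` I \<longleftrightarrow>
  Poly_Mapping.lookup a Var_t = 0 \<and> Poly_Mapping.lookup a Var_u = 0 \<and> xvars a \<subseteq> I"
proof safe
  assume *: "Poly_Mapping.keys a \<subseteq> Var_x ` I"
  show "Poly_Mapping.lookup a Var_t = 0" "Poly_Mapping.lookup a Var_u = 0"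
    using * by (auto simp: in_keys_iff)
  fix r assume "r \<in> xvars a"
  then show "r \<in> I"
    using * by (auto simp: in_keys_iff xvars_def subset_iff)
next
  fix v assume *: "Poly_Mapping.lookup a Var_t = 0" "Poly_Mapping.lookup a Var_u = 0" "xvars a \<subseteq> I" "v \<in> Poly_Mapping.keys a"
  then show "v \<in> Var_x ` I"
    by (cases v) (auto simp: in_keys_iff xvars_def)
qed

text \<open>
  Reduces each expansion to one coefficient computation: \<open>u\<^sup>i t\<^sup>j G\<close> with \<open>G\<close> free of \<open>t\<close> and \<open>u\<close> meets only the
  exponent vectors whose \<open>u\<close>- and \<open>t\<close>-entries are \<open>i\<close> and \<open>j\<close>.
\<close>

lemma has_sum_F_seriesI:
  fixes G :: "nat \<Rightarrow> nat \<Rightarrow> 'k :: field_char_0 series"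
  assumes G: "\<And>i j a. mcoeff (G i j) a = expansion_coeff I i j a"
  shows "((\<lambda>(i, j). u_var ^ i * t_var ^ j * G i j) has_sum F_series I) UNIV"
proof (rule has_sum_mfpsI[where h = "\<lambda>m. (Poly_Mapping.lookup m Var_u, Poly_Mapping.lookup m Var_t)"])
  define e :: "nat \<Rightarrow> nat \<Rightarrow> var \<Rightarrow>\<^sub>0 nat"
    where "e i j = Poly_Mapping.single Var_u i + Poly_Mapping.single Var_t j" for i j
  have e: "u_var ^ i * t_var ^ j = (mmonom 1 (e i j) :: 'k series)" for i j
    by (simp add: mvar_power_eq_mmonom mmonom_mult_mmonom e_def)
  fix m :: "var \<Rightarrow>\<^sub>0 nat"
  {
    fix x :: "nat \<times> nat"
    assume x: "x \<noteq> (Poly_Mapping.lookup m Var_u, Poly_Mapping.lookup m Var_t)"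
    obtain i j where ij: "x = (i, j)" by fastforce
    have "mcoeff (G i j) a = 0" if "m = e i j + a" for a
      using x unfolding G by (auto simp: ij expansion_coeff_def keys_subset_iff that e_def lookup_add lookup_single)
    then have "mcoeff (mmonom 1 (e i j) * G i j) m = 0"
      by (auto simp: mcoeff_mmonom_mult dest!: sym)
    then show "mcoeff (case x of (i, j) \<Rightarrow> u_var ^ i * t_var ^ j * G i j) m = 0"
      by (simp add: ij e)
  }
  let ?u = "Poly_Mapping.lookup m Var_u" and ?t = "Poly_Mapping.lookup m Var_t"
  have m: "e ?u ?t + (m - e ?u ?t) = m"
    by (rule poly_mapping_eqI) (auto simp: e_def lookup_add lookup_minus lookup_single when_def)
  obtain a where a: "m = e ?u ?t + a"
    using m by metis
  have "Poly_Mapping.lookup a Var_t = 0" "Poly_Mapping.lookup a Var_u = 0"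
    using arg_cong[OF a, of "\<lambda>p. Poly_Mapping.lookup p Var_t"] arg_cong[OF a, of "\<lambda>p. Poly_Mapping.lookup p Var_u"]
    by (simp_all add: e_def lookup_add lookup_single)
  moreover have "xvars m = xvars a" "xdeg m = xdeg a"
    using arg_cong[OF a, of xvars] arg_cong[OF a, of xdeg] by (simp_all add: e_def xvars_add xdeg_add)
  moreover have "a = m - e ?u ?t"
    using m a by (metis add_left_imp_eq)
  ultimately have "mcoeff (mmonom 1 (e ?u ?t) * G ?u ?t) m = mcoeff (F_closed z_var I) m"
    by (auto simp: mcoeff_mmonom_mult m G expansion_coeff_def mcoeff_F_closed keys_subset_iff)
  then show "mcoeff (F_series I) m = (if (?u, ?t) \<in> UNIV
      then mcoeff (case (?u, ?t) of (i, j) \<Rightarrow> u_var ^ i * t_var ^ j * G i j) m else 0)"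
    by (simp add: F_series_eq e)
qed

section \<open>Sums over partitions weighted by $1/z_\<mu>$\<close>

lemma sum_mset_eq_sum_count: "sum_mset \<mu> = (\<Sum>n\<in>set_mset \<mu>. n * count \<mu> n)" for \<mu> :: "nat multiset"
proof -
  have "sum_mset \<mu> = (\<Sum>n\<in>S. n * count \<mu> n)" if "finite S" "set_mset \<mu> \<subseteq> S" for S
    using that(2)
  proof (induction \<mu>)
    case (add x \<mu>)
    have "(\<Sum>n\<in>S. n * count (add_mset x \<mu>) n) = (\<Sum>n\<in>S. (if n = x then x else 0) + n * count \<mu> n)"
      by (rule sum.cong) auto
    also have "\<dots> = x + (\<Sum>n\<in>S. n * count \<mu> n)"
      using add.prems \<open>finite S\<close> by (simp add: sum.distrib)
    finally show ?case
      using add by simp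
  qed simp
  then show ?thesis by blast
qed

lemma z_part_add_mset: "z_part (add_mset n \<mu>) = n * Suc (count \<mu> n) * z_part \<mu>"
proof -
  let ?f = "\<lambda>\<mu> i. i ^ count \<mu> i * fact (count \<mu> i) :: nat"
  have z: "z_part \<nu> = ?f \<nu> n * (\<Prod>i\<in>set_mset \<nu> - {n}. ?f \<nu> i)" for \<nu>
    by (cases "n \<in># \<nu>") (simp_all add: z_part_def prod.remove not_in_iff)
  have "(\<Prod>i\<in>set_mset (add_mset n \<mu>) - {n}. ?f (add_mset n \<mu>) i) = (\<Prod>i\<in>set_mset \<mu> - {n}. ?f \<mu> i)"
    by (rule prod.cong) auto
  then show ?thesis
    by (simp add: z[of "add_mset n \<mu>"] z[of \<mu>] algebra_simps)
qed

text \<open>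
  Write \<open>j = \<Sum>\<^sub>n n m\<^sub>n(\<mu>)\<close> and remove one part \<open>n\<close> from \<open>\<mu>\<close>: since \<open>z\<^sub>\<mu> = n m\<^sub>n(\<mu>) z\<^sub>\<nu>\<close> for the remaining
  partition \<open>\<nu>\<close>, the weight \<open>n m\<^sub>n(\<mu>) / z\<^sub>\<mu>\<close> becomes \<open>1 / z\<^sub>\<nu>\<close>. For
  multiplicative \<open>h\<close> this is the logarithmic derivative of \<open>\<Sum>\<^sub>\<mu> h\<^sub>\<mu> / z\<^sub>\<mu> = exp (\<Sum>\<^sub>n h\<^sub>n / n)\<close>.
\<close>

lemma sum_partitions_recursion:
  fixes h :: "nat multiset \<Rightarrow> 'k :: field_char_0"
  shows "of_nat j * (\<Sum>\<mu>\<in>partitions j. h \<mu> / of_nat (z_part \<mu>)) =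
    (\<Sum>n = 1..j. \<Sum>\<nu>\<in>partitions (j - n). h (add_mset n \<nu>) / of_nat (z_part \<nu>))"
proof -
  let ?g = "\<lambda>\<mu> n. of_nat (n * count \<mu> n) * (h \<mu> / of_nat (z_part \<mu>))"
  have "of_nat j * (\<Sum>\<mu>\<in>partitions j. h \<mu> / of_nat (z_part \<mu>)) =
      (\<Sum>\<mu>\<in>partitions j. \<Sum>n\<in>set_mset \<mu>. ?g \<mu> n)"
    unfolding sum_distrib_left
  proof (rule sum.cong)
    fix \<mu> assume "\<mu> \<in> partitions j"
    then have "j = (\<Sum>n\<in>set_mset \<mu>. n * count \<mu> n)"
      by (simp add: partitions_def sum_mset_eq_sum_count)
    then show "of_nat j * (h \<mu> / of_nat (z_part \<mu>)) = (\<Sum>n\<in>set_mset \<mu>. ?g \<mu> n)"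
      by (metis of_nat_sum sum_distrib_right)
  qed simp
  also have "\<dots> = (\<Sum>(\<mu>, n)\<in>Sigma (partitions j) set_mset. ?g \<mu> n)"
    by (simp add: sum.Sigma finite_partitions)
  also have "\<dots> = (\<Sum>(n, \<nu>)\<in>Sigma {1..j} (\<lambda>n. partitions (j - n)). h (add_mset n \<nu>) / of_nat (z_part \<nu>))"
  proof (rule sum.reindex_bij_witness[where i = "\<lambda>(n, \<nu>). (add_mset n \<nu>, n)" and j = "\<lambda>(\<mu>, n). (n, \<mu> - {#n#})"])
    fix p assume p: "p \<in> Sigma {1..j} (\<lambda>n. partitions (j - n))"
    then show "(case case p of (n, \<nu>) \<Rightarrow> (add_mset n \<nu>, n) of (\<mu>, n) \<Rightarrow> (n, \<mu> - {#n#})) = p"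
      "(case p of (n, \<nu>) \<Rightarrow> (add_mset n \<nu>, n)) \<in> Sigma (partitions j) set_mset"
      by (auto simp: partitions_def)
  next
    fix p assume "p \<in> Sigma (partitions j) set_mset"
    then obtain \<mu> n where p: "p = (\<mu>, n)" "\<mu> \<in> partitions j" "n \<in># \<mu>" by auto
    then obtain \<nu> where \<mu>: "\<mu> = add_mset n \<nu>"
      by (metis insert_DiffM)
    show "(case case p of (\<mu>, n) \<Rightarrow> (n, \<mu> - {#n#}) of (n, \<nu>) \<Rightarrow> (add_mset n \<nu>, n)) = p"
      by (simp add: p(1) \<mu>)
    show "(case p of (\<mu>, n) \<Rightarrow> (n, \<mu> - {#n#})) \<in> Sigma {1..j} (\<lambda>n. partitions (j - n))"
      using p(2) by (auto simp: p(1) \<mu> partitions_def)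
    have "n > 0" "0 \<notin># \<nu>"
      using p(2) by (auto simp: \<mu> partitions_def)
    then have "of_nat (n * Suc (count \<nu> n)) \<noteq> (0 :: 'k)"
      by (simp only: of_nat_eq_0_iff) simp
    then have "h (add_mset n \<nu>) / of_nat (z_part \<nu>) =
        of_nat (n * Suc (count \<nu> n)) * (h (add_mset n \<nu>) / of_nat (n * Suc (count \<nu> n) * z_part \<nu>))"
      by (simp only: of_nat_mult[of "n * Suc (count \<nu> n)"] times_divide_eq_right mult_divide_mult_cancel_left not_False_eq_True)
    then show "(case case p of (\<mu>, n) \<Rightarrow> (n, \<mu> - {#n#}) of (n, \<nu>) \<Rightarrow> h (add_mset n \<nu>) / of_nat (z_part \<nu>)) =
        (case p of (\<mu>, n) \<Rightarrow> ?g \<mu> n)"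
      by (simp only: p(1) \<mu> z_part_add_mset prod.case add_mset_remove_trivial count_add_mset refl if_True)
  qed
  also have "\<dots> = (\<Sum>n = 1..j. \<Sum>\<nu>\<in>partitions (j - n). h (add_mset n \<nu>) / of_nat (z_part \<nu>))"
    by (simp add: sum.Sigma finite_partitions)
  finally show ?thesis .
qed

section \<open>The generating polynomial of the generalized binomial coefficients\<close>

lemma sum_card_Pow: "(\<Sum>C\<in>Pow A. v ^ card C) = (1 + v) ^ card A" if "finite A" for v :: "'a :: comm_ring_1"
  using prod_add[OF that, of "\<lambda>_. v" "\<lambda>_. 1"] by (simp add: add.commute)

lemma ferrers_mset: "ferrers \<mu> = Sigma {..<length xs} (\<lambda>r. {..<xs ! r})"
  if "xs = rev (sorted_list_of_multiset \<mu>)"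
proof -
  have "size \<mu> = length xs"
    by (simp add: that flip: size_mset)
  then show ?thesis
    by (auto simp: ferrers_def simp flip: that)
qed

lemma card_ferrers: "card (ferrers \<mu>) = sum_mset \<mu>"
proof -
  define xs where "xs = rev (sorted_list_of_multiset \<mu>)"
  have "sum_mset \<mu> = sum_list xs"
    by (simp add: xs_def flip: sum_mset_sum_list)
  also have "\<dots> = (\<Sum>r<length xs. xs ! r)"
    by (simp add: sum.list_conv_set_nth atLeast0LessThan)
  finally show ?thesis
    by (simp add: ferrers_mset[OF xs_def])
qed

text \<open>
  A selection of cells meeting every row is an independent choice of a nonempty set of cells in each
  row, and \<open>(1 + v)\<^sup>n - 1\<close> is the generating polynomial of the nonempty subsets of a row of length \<open>n\<close>.
\<close>

lemma partition_binom_gf: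
  fixes v :: "'a :: comm_ring_1"
  assumes "sum_mset \<mu> \<le> K"
  shows "(\<Sum>k\<le>K. of_nat (partition_binom \<mu> k) * v ^ k) = (\<Prod>n\<in>#\<mu>. (1 + v) ^ n - 1)"
proof -
  define xs where "xs = rev (sorted_list_of_multiset \<mu>)"
  have xs: "mset xs = \<mu>" and len: "size \<mu> = length xs"
    by (simp_all add: xs_def flip: size_mset)
  have ferrers: "ferrers \<mu> = Sigma {..<length xs} (\<lambda>r. {..<xs ! r})"
    by (rule ferrers_mset[OF xs_def])
  define A where "A = {S. S \<subseteq> ferrers \<mu> \<and> (\<forall>r<size \<mu>. \<exists>c. (r, c) \<in> S)}"
  have A: "finite A"
    unfolding A_def by (rule finite_subset[of _ "Pow (ferrers \<mu>)"]) (auto simp: finite_ferrers)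
  have card_le: "card S \<le> K" if "S \<in> A" for S
    using that assms card_mono[OF finite_ferrers, of S \<mu>] by (auto simp: A_def card_ferrers)
  have "(\<Sum>k\<le>K. of_nat (partition_binom \<mu> k) * v ^ k) = (\<Sum>k\<le>K. \<Sum>S | S \<in> A \<and> card S = k. v ^ card S)"
  proof (rule sum.cong)
    fix k
    have "partition_binom \<mu> k = card {S. S \<in> A \<and> card S = k}"
      unfolding partition_binom_def A_def by (rule arg_cong[where f = card]) auto
    then show "of_nat (partition_binom \<mu> k) * v ^ k = (\<Sum>S | S \<in> A \<and> card S = k. v ^ card S)"
      by simp
  qed simp
  also have "\<dots> = (\<Sum>S\<in>A. v ^ card S)"
    by (rule sum.group) (use A card_le in auto)
  \<comment> \<open>A set of cells is encoded by its rows.\<close>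
  also have "\<dots> = (\<Sum>g\<in>(\<Pi>\<^sub>E r\<in>{..<length xs}. Pow {..<xs ! r} - {{}}). \<Prod>r<length xs. v ^ card (g r))"
  proof (rule sum.reindex_bij_witness[where i = "\<lambda>g. Sigma {..<length xs} g"
        and j = "\<lambda>S. \<lambda>r\<in>{..<length xs}. {c. (r, c) \<in> S}"])
    fix S assume S: "S \<in> A"
    then show eq: "Sigma {..<length xs} (\<lambda>r\<in>{..<length xs}. {c. (r, c) \<in> S}) = S"
      by (auto simp: A_def ferrers)
    show "(\<lambda>r\<in>{..<length xs}. {c. (r, c) \<in> S}) \<in> (\<Pi>\<^sub>E r\<in>{..<length xs}. Pow {..<xs ! r} - {{}})"
      using S by (auto simp: A_def ferrers len)
    have "finite S"
      using S finite_ferrers by (auto simp: A_def intro: finite_subset)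
    then have "finite {c. (r, c) \<in> S}" for r
      by (rule finite_surj[of _ _ snd]) force
    then show "(\<Prod>r<length xs. v ^ card ((\<lambda>r\<in>{..<length xs}. {c. (r, c) \<in> S}) r)) = v ^ card S"
      by (subst (2) eq[symmetric]) (simp add: power_sum)
  next
    fix g assume g: "g \<in> (\<Pi>\<^sub>E r\<in>{..<length xs}. Pow {..<xs ! r} - {{}})"
    show "(\<lambda>r\<in>{..<length xs}. {c. (r, c) \<in> Sigma {..<length xs} g}) = g"
      using g by (fastforce simp: fun_eq_iff PiE_def extensional_def)
    show "Sigma {..<length xs} g \<in> A"
      using g by (fastforce simp: A_def ferrers len PiE_def Pi_def)
  qed
  also have "\<dots> = (\<Prod>r<length xs. \<Sum>C\<in>Pow {..<xs ! r} - {{}}. v ^ card C)"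
    by (rule prod_sum_PiE[symmetric]) auto
  also have "\<dots> = (\<Prod>r<length xs. (1 + v) ^ (xs ! r) - 1)"
    by (simp add: sum_diff1 sum_card_Pow)
  also have "\<dots> = (\<Prod>n\<in>#\<mu>. (1 + v) ^ n - 1)"
    by (simp add: prod_mset_prod_list prod.list_conv_set_nth atLeast0LessThan flip: xs mset_map)
  finally show ?thesis .
qed

lemma partition_binom_eq_0:
  assumes "sum_mset \<mu> < k"
  shows "partition_binom \<mu> k = 0"
proof -
  have "card S \<le> sum_mset \<mu>" if "S \<subseteq> ferrers \<mu>" for S
    using card_mono[OF finite_ferrers that] by (simp add: card_ferrers)
  then have "{S. S \<subseteq> ferrers \<mu> \<and> card S = k \<and> (\<forall>r<size \<mu>. \<exists>c. (r, c) \<in> S)} = {}"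
    using assms leD by blast
  then show ?thesis
    by (simp only: partition_binom_def card.empty)
qed

text \<open>
  The substitution \<open>v = y - 1\<close>, which moves one sign for each row and one for each chosen cell.
\<close>

lemma partition_binom_gf_signed:
  fixes y :: "'k :: field_char_0 fps"
  assumes "sum_mset \<mu> \<le> K"
  shows "(\<Sum>k\<le>K. fps_const ((- 1) powi (int k - int (size \<mu>)) * of_nat (partition_binom \<mu> k)) * (1 - y) ^ k)
    = (\<Prod>n\<in>#\<mu>. 1 - y ^ n)"
proof -
  have neg: "(\<Prod>n\<in>#\<nu>. 1 - y ^ n) = (- 1) ^ size \<nu> * (\<Prod>n\<in>#\<nu>. y ^ n - 1)" for \<nu>
    by (induction \<nu>) (simp_all add: algebra_simps)
  have "(\<Sum>k\<le>K. fps_const ((- 1) powi (int k - int (size \<mu>)) * of_nat (partition_binom \<mu> k)) * (1 - y) ^ k) =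
      (\<Sum>k\<le>K. (- 1) ^ size \<mu> * (of_nat (partition_binom \<mu> k) * (y - 1) ^ k))"
  proof (rule sum.cong)
    fix k
    have "(- 1 :: 'k) powi (int k - int (size \<mu>)) = (- 1) ^ size \<mu> * (- 1) ^ k"
      by (cases "even k"; cases "even (size \<mu>)") (simp_all add: power_int_diff)
    moreover have "(1 - y) ^ k = (- 1) ^ k * (y - 1) ^ k"
      by (simp flip: power_mult_distrib)
    ultimately show "fps_const ((- 1) powi (int k - int (size \<mu>)) * of_nat (partition_binom \<mu> k)) * (1 - y) ^ k =
        (- 1) ^ size \<mu> * (of_nat (partition_binom \<mu> k) * (y - 1) ^ k)"
      by (simp add: fps_of_nat flip: fps_const_mult fps_const_power fps_const_neg power_mult_distrib)
  qed simp
  also have "\<dots> = (\<Prod>n\<in>#\<mu>. 1 - y ^ n)"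
    using partition_binom_gf[OF assms, of "y - 1"] by (simp add: neg flip: sum_distrib_left)
  finally show ?thesis .
qed

section \<open>Multiplication by power sums\<close>

lemma mcoeff_x_power_mult:
  "mcoeff (x_var r ^ n * f) a = (if n \<le> Poly_Mapping.lookup a (Var_x r)
    then mcoeff f (a - Poly_Mapping.single (Var_x r) n) else 0)"
  by (simp add: mvar_power_eq_mmonom mcoeff_mmonom_mult single_divides_iff)

lemma power_sum_has_sum:
  assumes "n > 0"
  shows "((\<lambda>r. x_var r ^ n) has_sum (power_sum I n :: 'k :: field_char_0 series)) I"
proof -
  have "((\<lambda>r. x_var r ^ n) has_sum (Abs_mfps (\<lambda>m. if \<exists>r\<in>I. m = Poly_Mapping.single (Var_x r) n then 1 else 0) :: 'k series)) I"
  \<comment> \<open>On the monomials that occur, the only variable is the one returned by \<open>the_elem\<close>.\<close>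
  proof (rule has_sum_mfpsI[where h = "\<lambda>m. the_elem (xvars m)"])
    fix m :: "var \<Rightarrow>\<^sub>0 nat"
    have h: "the_elem (xvars m) = r" if "m = Poly_Mapping.single (Var_x r) n" for r
      using assms that by simp
    show "mcoeff (x_var r ^ n :: 'k series) m = 0" if "r \<noteq> the_elem (xvars m)" for r
      using h that by (auto simp: mvar_power_eq_mmonom)
    show "mcoeff (Abs_mfps (\<lambda>m. if \<exists>r\<in>I. m = Poly_Mapping.single (Var_x r) n then 1 else 0) :: 'k series) m =
        (if the_elem (xvars m) \<in> I then mcoeff (x_var (the_elem (xvars m)) ^ n) m else 0)"
      using h by (auto simp: mvar_power_eq_mmonom)
  qed
  then show ?thesis
    unfolding power_sum_def by (simp add: infsumI)
qed

text \<open>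
  By continuity, the infinite sum may be cut off at a finite set containing all \<open>r\<close> for which
  \<open>x\<^sub>r\<^sup>n\<close> divides the monomial in question.
\<close>

lemma mcoeff_power_sum_mult:
  assumes "n > 0"
  shows "mcoeff (power_sum I n * f) a =
    (\<Sum>r | r \<in> I \<and> n \<le> Poly_Mapping.lookup a (Var_x r). mcoeff f (a - Poly_Mapping.single (Var_x r) n))"
proof -
  let ?R = "{r \<in> I. n \<le> Poly_Mapping.lookup a (Var_x r)}"
  have R: "finite ?R"
    by (rule finite_subset[OF _ finite_xvars[of a]]) (use assms in \<open>auto simp: xvars_def\<close>)
  have "((\<lambda>Y. f * (\<Sum>r\<in>Y. x_var r ^ n)) \<longlongrightarrow> f * power_sum I n) (finite_subsets_at_top I)"
    using power_sum_has_sum[OF assms] by (intro tendsto_mult_left_mfps) (simp add: has_sum_def)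
  then have 1: "\<forall>\<^sub>F Y in finite_subsets_at_top I. mcoeff (f * (\<Sum>r\<in>Y. x_var r ^ n)) a = mcoeff (f * power_sum I n) a"
    by (simp add: tendsto_mfps_iff)
  have 2: "\<forall>\<^sub>F Y in finite_subsets_at_top I. finite Y \<and> ?R \<subseteq> Y \<and> Y \<subseteq> I"
    unfolding eventually_finite_subsets_at_top using R by (intro exI[of _ ?R]) auto
  obtain Y where Y: "finite Y" "?R \<subseteq> Y" "Y \<subseteq> I"
    and eq: "mcoeff (f * (\<Sum>r\<in>Y. x_var r ^ n)) a = mcoeff (f * power_sum I n) a"
    using eventually_happens'[OF finite_subsets_at_top_neq_bot eventually_conj[OF 1 2]] by blast
  have "mcoeff (power_sum I n * f) a = (\<Sum>r\<in>Y. mcoeff (x_var r ^ n * f) a)"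
    using eq by (simp add: mult.commute[of _ f] sum_distrib_left)
  also have "\<dots> = (\<Sum>r\<in>?R. mcoeff f (a - Poly_Mapping.single (Var_x r) n))"
    unfolding mcoeff_x_power_mult
    by (rule sum.mono_neutral_cong_right) (use Y in auto)
  finally show ?thesis .
qed

section \<open>The cycle index at $1 - y^n$\<close>

text \<open>
  The contribution of one variable of exponent \<open>N\<close> to the recursion for \<open>(1 - y)\<^sup>l\<close>. Removing \<open>x\<^sup>n\<close> from the
  monomial loses the variable exactly when \<open>n = N\<close>, hence the case distinction; the powers of \<open>y\<close>
  telescope.
\<close>

lemma one_variable_recursion:
  fixes y :: "'a :: comm_ring_1"
  assumes "N > 0" "l > 0"
  shows "(\<Sum>n = 1..N. (1 - y ^ n) * (1 - y) ^ (if n = N then l - 1 else l)) = of_nat N * (1 - y) ^ l"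
proof -
  obtain M k where N: "N = Suc M" and l: "l = Suc k"
    using assms gr0_implies_Suc by blast
  have *: "(1 - y) * (\<Sum>n = 1..M. 1 - y ^ n) + (1 - y ^ Suc M) = of_nat (Suc M) * (1 - y)" for M
    by (induction M) (simp_all add: algebra_simps)
  have "(\<Sum>n = 1..N. (1 - y ^ n) * (1 - y) ^ (if n = N then l - 1 else l)) =
      (\<Sum>n = 1..M. (1 - y ^ n) * (1 - y) ^ l) + (1 - y ^ Suc M) * (1 - y) ^ k"
    by (simp add: N l)
  also have "\<dots> = (1 - y) ^ k * ((1 - y) * (\<Sum>n = 1..M. 1 - y ^ n) + (1 - y ^ Suc M))"
    by (simp add: l sum_distrib_left sum_distrib_right algebra_simps)
  also have "\<dots> = of_nat N * (1 - y) ^ l"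
    unfolding * by (simp add: N l algebra_simps)
  finally show ?thesis .
qed

lemma exponent_minus_single:
  assumes "0 < n" "n \<le> Poly_Mapping.lookup a (Var_x r)"
  defines "b \<equiv> a - Poly_Mapping.single (Var_x r) n"
  shows "xdeg a = xdeg b + n"
    and "card (xvars b) = (if n = Poly_Mapping.lookup a (Var_x r) then card (xvars a) - 1 else card (xvars a))"
    and "r \<in> I \<Longrightarrow> Poly_Mapping.keys b \<subseteq> Var_x ` I \<longleftrightarrow> Poly_Mapping.keys a \<subseteq> Var_x ` I"
proof -
  have a: "Poly_Mapping.single (Var_x r) n + b = a"
    using assms(2) by (simp add: b_def single_divides_iff)
  show "xdeg a = xdeg b + n"
    by (simp flip: a add: xdeg_add)
  have "xvars b = (if n = Poly_Mapping.lookup a (Var_x r) then xvars a - {r} else xvars a)"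
    using assms(1,2) by (auto simp: b_def xvars_def lookup_minus lookup_single when_def)
  moreover have "r \<in> xvars a"
    using assms(1,2) by (simp add: xvars_def)
  ultimately show "card (xvars b) = (if n = Poly_Mapping.lookup a (Var_x r) then card (xvars a) - 1 else card (xvars a))"
    by simp
  show "Poly_Mapping.keys b \<subseteq> Var_x ` I \<longleftrightarrow> Poly_Mapping.keys a \<subseteq> Var_x ` I" if "r \<in> I"
    using assms(1) that unfolding keys_subset_iff by (simp flip: a add: lookup_add lookup_single xvars_add)
qed

lemma fps_const_sum: "fps_const (sum f A) = (\<Sum>x\<in>A. fps_const (f x))"
  by (rule fps_ext) (simp add: fps_sum_nth)

text \<open>
  A coefficientwise form of \<open>\<Sum>\<^sub>\<mu> p\<^sub>\<mu>/z\<^sub>\<mu> \<Prod>(1 - y\<^sup>n) = \<Prod>\<^sub>r (1 - y x\<^sub>r)/(1 - x\<^sub>r)\<close>, where the factor of \<open>r\<close> is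
  \<open>1 + (1 - y) (x\<^sub>r + x\<^sub>r\<^sup>2 + \<dots>)\<close>. Both sides satisfy \<open>j T\<^sub>j = \<Sum>\<^sub>n (1 - y\<^sup>n) p\<^sub>n T\<^sub>j\<^sub>-\<^sub>n\<close>: the left one by removal of a
  part, the right one by summing \<open>one_variable_recursion\<close> over the variables. The scalars are made
  elements of a field by evaluating the coefficients at \<open>z = c\<close>.
\<close>

lemma cycle_index_mcoeff:
  fixes y :: "'k :: field_char_0 fps" and c :: 'k and I :: "nat set"
  defines "P \<equiv> \<lambda>\<mu> a. poly (mcoeff (p_sym I \<mu>) a) c"
  shows "(\<Sum>\<mu>\<in>partitions j. fps_const (P \<mu> a / of_nat (z_part \<mu>)) * (\<Prod>n\<in>#\<mu>. 1 - y ^ n)) =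
    (if Poly_Mapping.keys a \<subseteq> Var_x ` I \<and> xdeg a = j then (1 - y) ^ card (xvars a) else 0)"
proof (induction j arbitrary: a rule: less_induct)
  case (less j)
  define w where "w \<mu> = (\<Prod>n\<in>#\<mu>. 1 - y ^ n)" for \<mu>
  define T where "T j a = (\<Sum>\<mu>\<in>partitions j. fps_const (P \<mu> a / of_nat (z_part \<mu>)) * w \<mu>)" for j a
  define V :: "nat \<Rightarrow> (var \<Rightarrow>\<^sub>0 nat) \<Rightarrow> 'k fps" where "V j a = (if Poly_Mapping.keys a \<subseteq> Var_x ` I \<and> xdeg a = j then (1 - y) ^ card (xvars a) else 0)" for j a
  have IH: "T j' a = V j' a" if "j' < j" for j' a
    using less.IH[OF that] by (simp add: T_def V_def w_def)
  have "T j a = V j a"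
  proof (cases "j = 0")
    case True
    have "partitions 0 = {{#}}"
      by (auto simp: partitions_def) (metis multiset_nonemptyE)
    moreover have "Poly_Mapping.keys a \<subseteq> Var_x ` I \<and> xdeg a = 0 \<longleftrightarrow> a = 0"
    proof
      assume *: "Poly_Mapping.keys a \<subseteq> Var_x ` I \<and> xdeg a = 0"
      show "a = 0"
      proof (rule poly_mapping_eqI)
        fix v show "Poly_Mapping.lookup a v = Poly_Mapping.lookup 0 v"
          using * by (cases v) (auto simp: keys_subset_iff xdeg_zero_iff xvars_def)
      qed
    qed (simp add: xdeg_zero_iff)
    ultimately show ?thesis
      by (auto simp: T_def V_def w_def True P_def p_sym_def z_part_def)
  next
    case False
    let ?R = "\<lambda>n. {r \<in> I. n \<le> Poly_Mapping.lookup a (Var_x r)}"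
    have step: "P (add_mset n \<nu>) a = (\<Sum>r\<in>?R n. P \<nu> (a - Poly_Mapping.single (Var_x r) n))" if "n > 0" for n \<nu>
      unfolding P_def p_sym_def by (simp add: mcoeff_power_sum_mult[OF that] poly_sum)
    have "of_nat j * T j a = (\<Sum>n = 1..j. \<Sum>\<nu>\<in>partitions (j - n).
        fps_const (P (add_mset n \<nu>) a / of_nat (z_part \<nu>)) * w (add_mset n \<nu>))"
    proof (rule fps_ext)
      fix i
      show "fps_nth (of_nat j * T j a) i = fps_nth (\<Sum>n = 1..j. \<Sum>\<nu>\<in>partitions (j - n).
        fps_const (P (add_mset n \<nu>) a / of_nat (z_part \<nu>)) * w (add_mset n \<nu>)) i"
        using sum_partitions_recursion[of j "\<lambda>\<mu>. P \<mu> a * fps_nth (w \<mu>) i"]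
        by (simp add: T_def fps_sum_nth flip: fps_of_nat)
    qed
    also have "\<dots> = (\<Sum>n = 1..j. \<Sum>r\<in>?R n. (1 - y ^ n) * T (j - n) (a - Poly_Mapping.single (Var_x r) n))"
    proof (rule sum.cong)
      fix n assume "n \<in> {1..j}"
      then have "(\<Sum>\<nu>\<in>partitions (j - n). fps_const (P (add_mset n \<nu>) a / of_nat (z_part \<nu>)) * w (add_mset n \<nu>)) =
          (\<Sum>\<nu>\<in>partitions (j - n). \<Sum>r\<in>?R n. (1 - y ^ n) *
            (fps_const (P \<nu> (a - Poly_Mapping.single (Var_x r) n) / of_nat (z_part \<nu>)) * w \<nu>))"
        by (intro sum.cong) (simp_all add: step w_def sum_divide_distrib sum_distrib_left sum_distrib_right mult_ac fps_const_sum)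
      also have "\<dots> = (\<Sum>r\<in>?R n. (1 - y ^ n) * T (j - n) (a - Poly_Mapping.single (Var_x r) n))"
        unfolding T_def sum_distrib_left by (rule sum.swap)
      finally show "(\<Sum>\<nu>\<in>partitions (j - n). fps_const (P (add_mset n \<nu>) a / of_nat (z_part \<nu>)) * w (add_mset n \<nu>)) = \<dots>" .
    qed simp
    also have "\<dots> = (\<Sum>n = 1..j. \<Sum>r\<in>?R n. if Poly_Mapping.keys a \<subseteq> Var_x ` I \<and> xdeg a = j then
        (1 - y ^ n) * (1 - y) ^ (if n = Poly_Mapping.lookup a (Var_x r) then card (xvars a) - 1 else card (xvars a)) else 0)"
    proof (intro sum.cong refl)
      fix n r assume n: "n \<in> {1..j}" and r: "r \<in> ?R n"
      have *: "0 < n" "n \<le> Poly_Mapping.lookup a (Var_x r)" "r \<in> I"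
        using n r by auto
      have "j - n < j"
        using n by auto
      then have "T (j - n) (a - Poly_Mapping.single (Var_x r) n) = V (j - n) (a - Poly_Mapping.single (Var_x r) n)"
        by (rule IH)
      then show "(1 - y ^ n) * T (j - n) (a - Poly_Mapping.single (Var_x r) n) = (if Poly_Mapping.keys a \<subseteq> Var_x ` I \<and> xdeg a = j then
        (1 - y ^ n) * (1 - y) ^ (if n = Poly_Mapping.lookup a (Var_x r) then card (xvars a) - 1 else card (xvars a)) else 0)"
        using n exponent_minus_single(1)[OF *(1,2)]
        by (auto simp: V_def exponent_minus_single(2)[OF *(1,2)] exponent_minus_single(3)[OF *])
    qed
    also have "\<dots> = of_nat j * V j a"
    proof (cases "Poly_Mapping.keys a \<subseteq> Var_x ` I \<and> xdeg a = j")
      case True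
      let ?f = "\<lambda>n r. (1 - y ^ n) * (1 - y) ^ (if n = Poly_Mapping.lookup a (Var_x r) then card (xvars a) - 1 else card (xvars a))"
      have R: "?R n = {r \<in> xvars a. n \<le> Poly_Mapping.lookup a (Var_x r)}" if "n \<in> {1..j}" for n
        using True that by (auto simp: keys_subset_iff xvars_def)
      have N: "{n \<in> {1..j}. n \<le> Poly_Mapping.lookup a (Var_x r)} = {1..Poly_Mapping.lookup a (Var_x r)}" if "r \<in> xvars a" for r
      proof -
        have "Poly_Mapping.lookup a (Var_x r) \<le> j"
          using True member_le_sum[OF that, of "\<lambda>r. Poly_Mapping.lookup a (Var_x r)"] by (simp add: xdeg_def)
        then show ?thesis by auto
      qed
      have "(\<Sum>n = 1..j. \<Sum>r\<in>?R n. ?f n r) = (\<Sum>n\<in>{1..j}. \<Sum>r | r \<in> xvars a \<and> n \<le> Poly_Mapping.lookup a (Var_x r). ?f n r)"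
        by (intro sum.cong R refl)
      also have "\<dots> = (\<Sum>r\<in>xvars a. \<Sum>n | n \<in> {1..j} \<and> n \<le> Poly_Mapping.lookup a (Var_x r). ?f n r)"
        by (rule sum.swap_restrict) auto
      also have "\<dots> = (\<Sum>r\<in>xvars a. \<Sum>n = 1..Poly_Mapping.lookup a (Var_x r). ?f n r)"
        by (intro sum.cong N refl)
      also have "\<dots> = (\<Sum>r\<in>xvars a. of_nat (Poly_Mapping.lookup a (Var_x r)) * (1 - y) ^ card (xvars a))"
      proof (intro sum.cong refl)
        fix r assume r: "r \<in> xvars a"
        then have "0 < card (xvars a)"
          by (auto simp: card_gt_0_iff)
        then show "(\<Sum>n = 1..Poly_Mapping.lookup a (Var_x r). ?f n r) = of_nat (Poly_Mapping.lookup a (Var_x r)) * (1 - y) ^ card (xvars a)"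
          using r by (intro one_variable_recursion) (auto simp: xvars_def)
      qed
      also have "\<dots> = of_nat (xdeg a) * (1 - y) ^ card (xvars a)"
        by (simp add: xdeg_def sum_distrib_right)
      finally show ?thesis
        using True by (simp add: V_def)
    next
      case bad: False
      show ?thesis
        unfolding V_def if_not_P[OF bad] by simp
    qed
    finally show ?thesis
      using False by simp
  qed
  then show ?case
    by (simp add: T_def V_def w_def)
qed

section \<open>The three expansions\<close>

lemma fps_binomial_minus_mult: "fps_binomial (c - of_nat k) = fps_binomial c * fps_binomial (- 1) ^ k"
  for c :: "'k :: field_char_0"
proof -
  have "c - of_nat k = c + of_nat k * (- 1)" by simp
  then show ?thesis
    by (simp only: fps_binomial_add_mult fps_binomial_power)
qed

lemma one_plus_X_mult: "(1 + fps_X) * fps_binomial (- 1) = (1 :: 'k :: field_char_0 fps)"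
  by (simp flip: fps_binomial_1 fps_binomial_add_mult)

lemma poly_binom_shift:
  "poly (binom w (int i - int k)) c = fps_nth (fps_X ^ k * fps_binomial (poly w c)) i"
  by (auto simp: poly_binom fps_X_power_mult_nth nat_diff_distrib)

lemma mcoeff_m_expansion:
  "mcoeff (\<Sum>\<mu> | \<mu> \<in> partitions j \<and> size \<mu> \<le> i.
      mconst (binom (z_var - of_nat (size \<mu>)) (int i - int (size \<mu>))) * m_sym I \<mu>) a
    = expansion_coeff I i j a"
proof -
  define \<tau> where "\<tau> = image_mset (Poly_Mapping.lookup a) (mset_set (Poly_Mapping.keys a))"
  have keys: "Poly_Mapping.keys a = Var_x ` xvars a" if "Poly_Mapping.keys a \<subseteq> Var_x ` I"
    using that by (auto simp: xvars_def in_keys_iff)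
  have "\<tau> \<in> partitions (xdeg a)" "size \<tau> = card (xvars a)" if "Poly_Mapping.keys a \<subseteq> Var_x ` I"
  proof -
    have "sum_mset \<tau> = (\<Sum>v\<in>Poly_Mapping.keys a. Poly_Mapping.lookup a v)"
      by (simp add: \<tau>_def sum_unfold_sum_mset)
    also have "\<dots> = xdeg a"
      unfolding keys[OF that] xdeg_def by (subst sum.reindex) (auto simp: inj_on_def)
    finally show "\<tau> \<in> partitions (xdeg a)"
      by (auto simp: partitions_def \<tau>_def in_keys_iff)
    show "size \<tau> = card (xvars a)"
      unfolding \<tau>_def keys[OF that] by (simp add: card_image inj_on_def)
  qed
  note \<tau> = this
  have "mcoeff (\<Sum>\<mu> | \<mu> \<in> partitions j \<and> size \<mu> \<le> i.
      mconst (binom (z_var - of_nat (size \<mu>)) (int i - int (size \<mu>))) * m_sym I \<mu>) a =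
    (\<Sum>\<mu> | \<mu> \<in> partitions j \<and> size \<mu> \<le> i. if \<mu> = \<tau> then (if Poly_Mapping.keys a \<subseteq> Var_x ` I
       then binom (z_var - of_nat (size \<tau>)) (int i - int (size \<tau>)) else 0) else 0)"
    unfolding mcoeff_sum by (rule sum.cong) (auto simp: m_sym_def \<tau>_def)
  also have "\<dots> = (if \<tau> \<in> partitions j \<and> size \<tau> \<le> i \<and> Poly_Mapping.keys a \<subseteq> Var_x ` I
       then binom (z_var - of_nat (size \<tau>)) (int i - int (size \<tau>)) else 0)"
    by (subst sum.delta) (auto simp: finite_partitions)
  also have "\<dots> = expansion_coeff I i j a"
    using \<tau> by (auto simp: expansion_coeff_def partitions_def)
  finally show ?thesis .
qed

text \<open>
  At \<open>y = 1/(1+u)\<close> the factor \<open>1 - y\<close> is \<open>u/(1+u)\<close>, so a monomial in \<open>l\<close> variables receives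
  \<open>(1 + u)\<^sup>c (u/(1+u))\<^sup>l\<close>, as in the product that defines \<open>F\<close>.
\<close>

lemma cycle_index_binomial:
  fixes c :: "'k :: field_char_0" and I :: "nat set"
  defines "P \<equiv> \<lambda>\<mu> a. poly (mcoeff (p_sym I \<mu>) a) c"
  shows "poly (expansion_coeff I i j a) c = fps_nth (fps_binomial c *
    (\<Sum>\<mu>\<in>partitions j. fps_const (P \<mu> a / of_nat (z_part \<mu>)) * (\<Prod>n\<in>#\<mu>. 1 - fps_binomial (- 1) ^ n))) i"
proof -
  have y: "1 - fps_binomial (- 1) = fps_X * fps_binomial (- 1 :: 'k)"
    using one_plus_X_mult[where 'k = 'k] by (simp add: algebra_simps)
  show ?thesis
    unfolding P_def cycle_index_mcoeff y
    by (simp add: expansion_coeff_def poly_binom_shift fps_binomial_minus_mult power_mult_distrib mult_ac)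
qed

text \<open>
  Here \<open>1 - y\<^sup>n = y\<^sup>n ((1 + u)\<^sup>n - 1)\<close> is used for every part, so the powers of \<open>y\<close> collect to
  \<open>y\<^sup>j\<close> and the generating polynomial is taken at \<open>v = u\<close>.
\<close>

lemma mcoeff_p_expansion:
  "mcoeff (\<Sum>k = 0..min i j. mconst (binom (z_var - of_nat j) (int i - int k)) *
      (\<Sum>\<mu>\<in>partitions j. scalar (of_nat (partition_binom \<mu> k) / of_nat (z_part \<mu>)) * p_sym I \<mu>)) a
    = (expansion_coeff I i j a :: 'k :: field_char_0 poly)"
proof (rule poly_eqI_eval)
  fix c :: 'k
  define P where "P \<mu> = poly (mcoeff (p_sym I \<mu>) a) c" for \<mu>
  let ?y = "fps_binomial (- 1 :: 'k)" and ?B = "fps_binomial c"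
  let ?B' = "fps_binomial (c - of_nat j)"
  have B': "?B' * (\<Sum>k\<le>j. of_nat (partition_binom \<mu> k) * fps_X ^ k) = ?B * (\<Prod>n\<in>#\<mu>. 1 - ?y ^ n)"
    if "\<mu> \<in> partitions j" for \<mu>
  proof -
    have \<mu>: "sum_mset \<mu> = j"
      using that by (simp add: partitions_def)
    have "?y ^ sum_mset \<nu> * (\<Prod>n\<in>#\<nu>. (1 + fps_X) ^ n - 1) = (\<Prod>n\<in>#\<nu>. 1 - ?y ^ n)" for \<nu>
    proof (induction \<nu>)
      case (add n \<nu>)
      have "?y ^ n * (1 + fps_X) ^ n = 1"
        by (simp flip: power_mult_distrib add: one_plus_X_mult mult.commute[of ?y])
      then have "?y ^ n * ((1 + fps_X) ^ n - 1) = 1 - ?y ^ n"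
        by (simp only: right_diff_distrib mult_1_right)
      then show ?case
        by (simp add: power_add flip: add.IH)
    qed simp
    from this[of \<mu>] show ?thesis
      by (simp only: partition_binom_gf \<mu> order_refl fps_binomial_minus_mult mult.assoc)
  qed
  have "poly (mcoeff (\<Sum>k = 0..min i j. mconst (binom (z_var - of_nat j) (int i - int k)) *
      (\<Sum>\<mu>\<in>partitions j. scalar (of_nat (partition_binom \<mu> k) / of_nat (z_part \<mu>)) * p_sym I \<mu>)) a) c =
    (\<Sum>k = 0..min i j. fps_nth (fps_X ^ k * ?B') i *
      (\<Sum>\<mu>\<in>partitions j. of_nat (partition_binom \<mu> k) / of_nat (z_part \<mu>) * P \<mu>))"
    by (simp add: poly_sum poly_binom_shift P_def)
  also have "\<dots> = (\<Sum>k\<le>j. fps_nth (fps_X ^ k * ?B') i *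
      (\<Sum>\<mu>\<in>partitions j. of_nat (partition_binom \<mu> k) / of_nat (z_part \<mu>) * P \<mu>))"
    by (rule sum.mono_neutral_left) (auto simp: fps_X_power_mult_nth)
  also have "\<dots> = fps_nth (\<Sum>k\<le>j. \<Sum>\<mu>\<in>partitions j. fps_const (P \<mu> / of_nat (z_part \<mu>)) *
      (fps_const (of_nat (partition_binom \<mu> k)) * (fps_X ^ k * ?B'))) i"
    unfolding fps_sum_nth fps_mult_left_const_nth sum_distrib_left by (intro sum.cong) simp_all
  also have "(\<Sum>k\<le>j. \<Sum>\<mu>\<in>partitions j. fps_const (P \<mu> / of_nat (z_part \<mu>)) *
      (fps_const (of_nat (partition_binom \<mu> k)) * (fps_X ^ k * ?B'))) =
    (\<Sum>k\<le>j. \<Sum>\<mu>\<in>partitions j. fps_const (P \<mu> / of_nat (z_part \<mu>)) *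
      (?B' * (of_nat (partition_binom \<mu> k) * fps_X ^ k)))"
    by (simp only: fps_of_nat mult_ac)
  also have "(\<Sum>k\<le>j. \<Sum>\<mu>\<in>partitions j. fps_const (P \<mu> / of_nat (z_part \<mu>)) *
      (?B' * (of_nat (partition_binom \<mu> k) * fps_X ^ k))) =
      ?B * (\<Sum>\<mu>\<in>partitions j. fps_const (P \<mu> / of_nat (z_part \<mu>)) * (\<Prod>n\<in>#\<mu>. 1 - ?y ^ n))"
    unfolding sum_distrib_left
    by (subst sum.swap, rule sum.cong) (simp_all add: B' mult.left_commute[of ?B] flip: sum_distrib_left)
  also have "fps_nth \<dots> i = poly (expansion_coeff I i j a) c"
    by (simp add: cycle_index_binomial P_def)
  finally show "poly (mcoeff (\<Sum>k = 0..min i j. mconst (binom (z_var - of_nat j) (int i - int k)) *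
      (\<Sum>\<mu>\<in>partitions j. scalar (of_nat (partition_binom \<mu> k) / of_nat (z_part \<mu>)) * p_sym I \<mu>)) a) c =
    poly (expansion_coeff I i j a) c" .
qed

text \<open>
  Here \<open>y = 1 - u/(1+u)\<close> is used instead, so the generating polynomial is taken at \<open>v = -u/(1+u)\<close> and
  every chosen cell carries its own factor \<open>1/(1+u)\<close>.
\<close>

lemma mcoeff_signed_p_expansion:
  "mcoeff (\<Sum>\<^sub>\<infinity>k. mconst (binom (z_var - of_nat k) (int i - int k)) *
      (\<Sum>\<mu>\<in>partitions j. scalar ((- 1) powi (int k - int (size \<mu>)) *
        of_nat (partition_binom \<mu> k) / of_nat (z_part \<mu>)) * p_sym I \<mu>)) a
    = (expansion_coeff I i j a :: 'k :: field_char_0 poly)"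
proof (rule poly_eqI_eval)
  fix c :: 'k
  define P where "P \<mu> = poly (mcoeff (p_sym I \<mu>) a) c" for \<mu>
  define s where "s \<mu> k = (- 1 :: 'k) powi (int k - int (size \<mu>)) * of_nat (partition_binom \<mu> k)" for \<mu> k
  define g :: "nat \<Rightarrow> 'k series" where "g k = mconst (binom (z_var - of_nat k) (int i - int k)) *
      (\<Sum>\<mu>\<in>partitions j. scalar (s \<mu> k / of_nat (z_part \<mu>)) * p_sym I \<mu>)" for k
  let ?y = "fps_binomial (- 1 :: 'k)" and ?B = "fps_binomial c"
  have y: "fps_X * ?y = 1 - ?y"
    using one_plus_X_mult[where 'k = 'k] by (simp add: algebra_simps)
  have "g k = 0" if "k \<notin> {..j}" for k
    using that by (simp add: g_def s_def partitions_def partition_binom_eq_0 mconst_def flip: zero_mfps_def)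
  then have "infsum g UNIV = infsum g {..j}"
    by (intro infsum_cong_neutral) auto
  then have "poly (mcoeff (infsum g UNIV) a) c = (\<Sum>k\<le>j. fps_nth (fps_X ^ k * fps_binomial (c - of_nat k)) i *
      (\<Sum>\<mu>\<in>partitions j. s \<mu> k / of_nat (z_part \<mu>) * P \<mu>))"
    by (simp add: g_def poly_sum poly_binom_shift P_def)
  also have "\<dots> = fps_nth (\<Sum>k\<le>j. \<Sum>\<mu>\<in>partitions j. fps_const (P \<mu> / of_nat (z_part \<mu>)) *
      (fps_const (s \<mu> k) * (fps_X ^ k * fps_binomial (c - of_nat k)))) i"
    unfolding fps_sum_nth fps_mult_left_const_nth sum_distrib_left by (intro sum.cong) simp_all
  also have "(\<Sum>k\<le>j. \<Sum>\<mu>\<in>partitions j. fps_const (P \<mu> / of_nat (z_part \<mu>)) *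
      (fps_const (s \<mu> k) * (fps_X ^ k * fps_binomial (c - of_nat k)))) =
    (\<Sum>k\<le>j. \<Sum>\<mu>\<in>partitions j. fps_const (P \<mu> / of_nat (z_part \<mu>)) *
      (?B * (fps_const (s \<mu> k) * (1 - ?y) ^ k)))"
    by (simp only: fps_binomial_minus_mult power_mult_distrib mult_ac flip: y)
  also have "(\<Sum>k\<le>j. \<Sum>\<mu>\<in>partitions j. fps_const (P \<mu> / of_nat (z_part \<mu>)) *
      (?B * (fps_const (s \<mu> k) * (1 - ?y) ^ k))) =
      ?B * (\<Sum>\<mu>\<in>partitions j. fps_const (P \<mu> / of_nat (z_part \<mu>)) * (\<Prod>n\<in>#\<mu>. 1 - ?y ^ n))"
  proof -
    have "(\<Sum>k\<le>j. fps_const (P \<mu> / of_nat (z_part \<mu>)) * (?B * (fps_const (s \<mu> k) * (1 - ?y) ^ k))) =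
        ?B * (fps_const (P \<mu> / of_nat (z_part \<mu>)) * (\<Prod>n\<in>#\<mu>. 1 - ?y ^ n))" if "\<mu> \<in> partitions j" for \<mu>
    proof -
      have "sum_mset \<mu> \<le> j"
        using that by (simp add: partitions_def)
      then show ?thesis
        unfolding s_def sum_distrib_left[symmetric] by (simp only: partition_binom_gf_signed mult.left_commute)
    qed
    then show ?thesis
      unfolding sum_distrib_left[of ?B] by (subst sum.swap) (intro sum.cong refl)
  qed
  also have "fps_nth \<dots> i = poly (expansion_coeff I i j a) c"
    by (simp add: cycle_index_binomial P_def)
  finally show "poly (mcoeff (\<Sum>\<^sub>\<infinity>k. mconst (binom (z_var - of_nat k) (int i - int k)) *
      (\<Sum>\<mu>\<in>partitions j. scalar ((- 1) powi (int k - int (size \<mu>)) *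
        of_nat (partition_binom \<mu> k) / of_nat (z_part \<mu>)) * p_sym I \<mu>)) a) c = poly (expansion_coeff I i j a) c"
    by (simp only: g_def s_def)
qed

theorem mainTheorem3:
  fixes I :: "nat set"
  shows
    "((\<lambda>(i, j). u_var ^ i * t_var ^ j *
        (\<Sum>\<mu> | \<mu> \<in> partitions j \<and> size \<mu> \<le> i.
          mconst (binom (z_var - of_nat (size \<mu>)) (int i - int (size \<mu>))) * m_sym I \<mu>))
      has_sum (F_series I :: 'k :: field_char_0 series)) UNIV \<and>
     ((\<lambda>(i, j). u_var ^ i * t_var ^ j *
        (\<Sum>k = 0..min i j. mconst (binom (z_var - of_nat j) (int i - int k)) *
          (\<Sum>\<mu>\<in>partitions j.
            scalar (of_nat (partition_binom \<mu> k) / of_nat (z_part \<mu>)) * p_sym I \<mu>)))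
      has_sum (F_series I :: 'k :: field_char_0 series)) UNIV \<and>
     ((\<lambda>(i, j). u_var ^ i * t_var ^ j *
        (\<Sum>\<^sub>\<infinity>k. mconst (binom (z_var - of_nat k) (int i - int k)) *
          (\<Sum>\<mu>\<in>partitions j.
            scalar ((- 1) powi (int k - int (size \<mu>)) *
              of_nat (partition_binom \<mu> k) / of_nat (z_part \<mu>)) * p_sym I \<mu>)))
      has_sum (F_series I :: 'k :: field_char_0 series)) UNIV"
  by (intro conjI has_sum_F_seriesI mcoeff_m_expansion mcoeff_p_expansion mcoeff_signed_p_expansion)

end
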